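(* Let $n\ge 2$ and let $\mathcal{B}=\{B_0,\dots,B_n\}$ be a complete set of mutually unbiased bases of $\mathbb{C}^n$. For each $i$ let $H_i$ be the set of all traceless $n\times n$ complex matrices that are diagonal with respect to the basis $B_i$ (i.e. every vector of $B_i$ is an eigenvector of every matrix in $H_i$), so that $\mathcal{D}: sl_n(\mathbb{C})=H_0\oplus H_1\oplus\cdots\oplus H_n$ is the orthogonal decomposition of $sl_n(\mathbb{C})$ corresponding to $\mathcal{B}$. Then ${\rm Aut}(\mathcal{D})\cong {\rm Aut}(\mathcal{B})$.
   Context: A complete set of mutually unbiased bases (MUBs) of $\mathbb{C}^n$ is a set of $n+1$ orthonormal bases $B_0,\dots,B_n$ of $\mathbb{C}^n$ (standard Hermitian inner product) such that $|(x,y)|^2=1/n$ whenever $x,y$ lie in distinct bases. $sl_n(\mathbb{C})$ is the Lie algebra of traceless complex $n\times n$ matrices with bracket $[A,B]=AB-BA$. An orthogonal decomposition of $sl_n(\mathbb{C})$ is a direct sum decomposition into Cartan subalgebras pairwise orthogonal with respect to the Killing form $K(A,B)=2n\,{\rm Tr}(AB)$. ${\rm Aut}(\mathcal{D})=\{\varphi\in{\rm Aut}(sl_n(\mathbb{C}))\mid \forall i\,\exists j:\ \varphi(H_i)=H_j\}$, where ${\rm Aut}(sl_n(\mathbb{C}))$ is the full Lie algebra automorphism group (generated by the inner automorphisms $A\mapsto XAX^{-1}$ and $A\mapsto -A^t$). For an orthonormal basis $B_i$, its orthoframe $Ort(B_i)$ is the set of $1$-dimensional subspaces spanned by the vectors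 of $B_i$. Let $\tau$ be the coordinatewise complex conjugation $(x_1,\dots,x_n)\mapsto(\overline{x_1},\dots,\overline{x_n})$ with respect to a fixed standard basis, and $PGL_n(\mathbb{C})^+=PGL_n(\mathbb{C})\langle\tau\rangle$, acting on $1$-dimensional subspaces of $\mathbb{C}^n$. Then ${\rm Aut}(\mathcal{B})=\{\psi\in PGL_n(\mathbb{C})^+\mid \forall i\,\exists j:\ \psi(Ort(B_i))=Ort(B_j)\}$.
   Formalization: The isomorphism Aut(D) ≅ Aut(B) is asserted only for n ≥ 3, since for n = 2 it is false: Aut(D) has order 24 while Aut(B) has order 48; the orthogonal decomposition is proved for all n ≥ 2. *)

theory Defs
  imports "HOL-Analysis.Analysis" "HOL-Algebra.Bij" "HOL-Algebra.Generated_Groups"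
begin

section \<open>Complete sets of mutually unbiased bases\<close>

definition herm :: "complex^'n \<Rightarrow> complex^'n \<Rightarrow> complex" where
  "herm x y = (\<Sum>i\<in>UNIV. x $ i * cnj (y $ i))"

text \<open>\<open>vec.independent\<close> and \<open>vec.span\<close> are the notions over the scalar field \<open>complex\<close>,
  unlike the real notions \<open>independent\<close> and \<open>span\<close>.\<close>

definition orthonormal_basis :: "(complex^'n) set \<Rightarrow> bool" where
  "orthonormal_basis E \<longleftrightarrow> vec.independent E \<and> vec.span E = UNIV \<and>
     (\<forall>x\<in>E. \<forall>y\<in>E. herm x y = (if x = y then 1 else 0))"

definition complete_MUB :: "(nat \<Rightarrow> (complex^'n) set) \<Rightarrow> bool" where
  "complete_MUB B \<longleftrightarrow> (\<forall>i\<le>CARD('n). orthonormal_basis (B i)) \<and>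
     (\<forall>i\<le>CARD('n). \<forall>j\<le>CARD('n). i \<noteq> j \<longrightarrow>
        (\<forall>x\<in>B i. \<forall>y\<in>B j. (cmod (herm x y))\<^sup>2 = 1 / real CARD('n)))"

section \<open>The Lie algebra of traceless matrices\<close>

definition mat_scale :: "complex \<Rightarrow> complex^'n^'n \<Rightarrow> complex^'n^'n" where
  "mat_scale c A = (\<chi> i j. c * A $ i $ j)"

global_interpretation mat_vs: vector_space mat_scale
  by unfold_locales (simp_all add: mat_scale_def vec_eq_iff algebra_simps)

definition sl :: "(complex^'n^'n) set" where
  "sl = {A. trace A = 0}"

definition lie :: "complex^'n^'n \<Rightarrow> complex^'n^'n \<Rightarrow> complex^'n^'n" where
  "lie A B = A ** B - B ** A"

definition killing :: "complex^'n^'n \<Rightarrow> complex^'n^'n \<Rightarrow> complex" where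
  "killing A B = 2 * of_nat CARD('n) * trace (A ** B)"

definition lie_subalgebra :: "(complex^'n^'n) set \<Rightarrow> bool" where
  "lie_subalgebra L \<longleftrightarrow> L \<subseteq> sl \<and> mat_vs.subspace L \<and> (\<forall>A\<in>L. \<forall>B\<in>L. lie A B \<in> L)"

primrec lower_central :: "(complex^'n^'n) set \<Rightarrow> nat \<Rightarrow> (complex^'n^'n) set" where
  "lower_central L 0 = L"
| "lower_central L (Suc k) = mat_vs.span {lie A B | A B. A \<in> L \<and> B \<in> lower_central L k}"

definition nilpotent_algebra :: "(complex^'n^'n) set \<Rightarrow> bool" where
  "nilpotent_algebra L \<longleftrightarrow> (\<exists>k. lower_central L k = {0})"

definition cartan_subalgebra :: "(complex^'n^'n) set \<Rightarrow> bool" where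
  "cartan_subalgebra L \<longleftrightarrow> lie_subalgebra L \<and> nilpotent_algebra L \<and>
     {A \<in> sl. \<forall>B\<in>L. lie A B \<in> L} = L"

text \<open>The components are \<open>H 0, \<dots>, H n\<close> with \<open>n = CARD('n)\<close>.  The sum is direct: every traceless
  matrix has exactly one family of components (made unique as a function by \<open>PiE\<close>).\<close>

definition orthogonal_decomposition :: "(nat \<Rightarrow> (complex^'n^'n) set) \<Rightarrow> bool" where
  "orthogonal_decomposition H \<longleftrightarrow>
     (\<forall>i\<le>CARD('n). cartan_subalgebra (H i)) \<and>
     (\<forall>A\<in>sl. \<exists>!f. f \<in> PiE {..CARD('n)} H \<and> A = (\<Sum>i\<le>CARD('n). f i)) \<and>
     (\<forall>i\<le>CARD('n). \<forall>j\<le>CARD('n). i \<noteq> j \<longrightarrow> (\<forall>A\<in>H i. \<forall>B\<in>H j. killing A B = 0))"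

definition diagonal_algebra :: "(complex^'n) set \<Rightarrow> (complex^'n^'n) set" where
  "diagonal_algebra E = {A \<in> sl. \<forall>x\<in>E. \<exists>c. A *v x = c *s x}"

section \<open>Automorphisms of a decomposition\<close>

definition lie_automorphisms :: "(complex^'n^'n \<Rightarrow> complex^'n^'n) set" where
  "lie_automorphisms = {\<phi> \<in> Bij sl.
     (\<forall>A\<in>sl. \<forall>B\<in>sl. \<phi> (A + B) = \<phi> A + \<phi> B) \<and>
     (\<forall>c. \<forall>A\<in>sl. \<phi> (mat_scale c A) = mat_scale c (\<phi> A)) \<and>
     (\<forall>A\<in>sl. \<forall>B\<in>sl. \<phi> (lie A B) = lie (\<phi> A) (\<phi> B))}"

definition Aut_decomposition ::
    "(nat \<Rightarrow> (complex^'n^'n) set) \<Rightarrow> (complex^'n^'n \<Rightarrow> complex^'n^'n) monoid" where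
  "Aut_decomposition H = (BijGroup sl)
     \<lparr>carrier := {\<phi> \<in> lie_automorphisms. \<forall>i\<le>CARD('n). \<exists>j\<le>CARD('n). \<phi> ` H i = H j}\<rparr>"

section \<open>Automorphisms of a complete set of mutually unbiased bases\<close>

definition conjugation :: "complex^'n \<Rightarrow> complex^'n" where
  "conjugation x = (\<chi> i. cnj (x $ i))"

definition GL_maps :: "(complex^'n \<Rightarrow> complex^'n) set" where
  "GL_maps = {(*v) X | X. invertible X}"

definition scalar_maps :: "(complex^'n \<Rightarrow> complex^'n) set" where
  "scalar_maps = {(*s) c | c. c \<noteq> 0}"

definition GL_plus :: "(complex^'n \<Rightarrow> complex^'n) monoid" where
  "GL_plus = (BijGroup UNIV)\<lparr>carrier := generate (BijGroup UNIV) (insert conjugation GL_maps)\<rparr>"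

text \<open>The extension of \<open>PGL\<close> by \<open>conjugation\<close>: the scalars form a normal subgroup of \<open>GL_plus\<close>,
  although conjugation does not centralise them, and \<open>PGL\<close> is the image of \<open>GL\<close> in the quotient.\<close>

definition PGL_plus :: "(complex^'n \<Rightarrow> complex^'n) set monoid" where
  "PGL_plus = GL_plus Mod scalar_maps"

text \<open>Elements of \<open>PGL_plus\<close> are cosets.  All maps in a coset \<open>\<Psi>\<close> have the same image on a line
  \<open>L\<close>, so the union is the image under any representative.\<close>

definition line_action ::
    "(complex^'n \<Rightarrow> complex^'n) set \<Rightarrow> (complex^'n) set \<Rightarrow> (complex^'n) set" where
  "line_action \<Psi> L = (\<Union>f\<in>\<Psi>. f ` L)"

definition Ort :: "(complex^'n) set \<Rightarrow> (complex^'n) set set" where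
  "Ort E = {vec.span {x} | x. x \<in> E}"

definition Aut_MUB ::
    "(nat \<Rightarrow> (complex^'n) set) \<Rightarrow> (complex^'n \<Rightarrow> complex^'n) set monoid" where
  "Aut_MUB B = PGL_plus
     \<lparr>carrier := {\<Psi> \<in> carrier PGL_plus.
        \<forall>i\<le>CARD('n). \<exists>j\<le>CARD('n). line_action \<Psi> ` Ort (B i) = Ort (B j)}\<rparr>"

text \<open>For \<open>n = 2\<close> the groups \<open>Aut_decomposition\<close> and \<open>Aut_MUB\<close> are not isomorphic: every
  automorphism of \<open>sl\<close> is then inner, including \<open>A \<mapsto> - A\<^sup>T\<close>, whereas conjugation stays outside
  \<open>PGL\<close>.  In the Bloch sphere picture the three bases are the axes of an octahedron;
  \<open>Aut_decomposition\<close> is its rotation group (order 24) and \<open>Aut_MUB\<close> its full symmetry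
  group (order 48).\<close>

end

theory Submission
  imports Defs
begin

text \<open>Write \<open>P\<^sub>x\<close> for the orthogonal projection onto a unit vector \<open>x\<close> and \<open>e\<^sub>x = P\<^sub>x - 1/n\<close>.
  A semilinear map permuting the orthoframes is unitary up to a scalar, because \<open>X\<^sup>*X\<close> is
  diagonal in two unbiased bases; hence \<open>X \<mapsto> (A \<mapsto> X A X\<^sup>-\<^sup>1)\<close> and \<open>X\<tau> \<mapsto> (A \<mapsto> - X A\<^sup>t X\<^sup>-\<^sup>1)\<close> together
  form a homomorphism, whose kernel consists of the scalars when \<open>n \<ge> 3\<close>.

  For surjectivity no classification of the automorphisms of \<open>sl\<^sub>n\<close> is needed.  An automorphism
  \<open>\<phi>\<close> preserves the trace form, and \<open>ad\<^sup>3 = ad\<close> for \<open>e\<^sub>x\<close>, so \<open>\<phi>(e\<^sub>x)\<close> takes two adjacent values on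
  a basis and its norm forces \<open>\<phi>(e\<^sub>x) = \<plusminus> e\<^sub>y\<close>.  For \<open>n \<ge> 3\<close> the sign is the same for all \<open>x\<close>.
  Then \<open>\<plusminus>\<phi>\<close>, extended by the identity on scalars, preserves the Jordan product with every
  \<open>P\<^sub>x\<close>, and the \<open>P\<^sub>x\<close> span all matrices, so it is an automorphism or an anti-automorphism of
  the matrix algebra, and Skolem--Noether applies.\<close>

section \<open>Matrix algebra\<close>

text \<open>The pairing of \<tau> with \<open>A \<mapsto> - A^t\<close> depends on how each passes a
  matrix \<open>Y\<close>: \<tau> turns \<open>Y\<close> into its entrywise conjugate, the
  contragredient into its inverse transpose. The two agree modulo scalars exactly when
  \<open>Y\<close> is unitary up to a scalar. The assignment is therefore multiplicative on maps
  permuting the orthoframes but not, in general, on all of \<open>GL_plus\<close>. The spanning of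
  the \<open>P\<^sub>x\<close> comes with a formula: \<open>n + 1\<close> mutually unbiased bases
  satisfy \<open>A + tr(A) I = \<Sum> tr(A P\<^sub>x) P\<^sub>x\<close>. The same formula produces
  the components of the direct sum. The trace form is preserved because the extension of
  \<open>\<phi>\<close> to all matrices, by the identity on scalars, conjugates \<open>ad A\<close>
  into \<open>ad (\<phi> A)\<close>. The dimension enters through the number \<open>2/n\<close>: it
  is excluded as a trace of two projections when signs are compared, and as an eigenvalue of an
  idempotent when the kernel is computed.\<close>

lemma matrix_add_rdistrib: "(A + B) ** C = A ** C + B ** (C :: 'a::semiring_1^'n^'m)"
  by (simp add: matrix_matrix_mult_def vec_eq_iff distrib_right sum.distrib)

lemma matrix_diff_ldistrib: "A ** (B - C) = A ** B - A ** (C :: 'a::ring_1^'n^'m)"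
  by (simp add: matrix_matrix_mult_def vec_eq_iff right_diff_distrib sum_subtractf)

lemma matrix_diff_rdistrib: "(A - B) ** C = A ** C - B ** (C :: 'a::ring_1^'n^'m)"
  by (simp add: matrix_matrix_mult_def vec_eq_iff left_diff_distrib sum_subtractf)

lemma matrix_minus_left: "(- A) ** B = - (A ** (B :: 'a::ring_1^'n^'m))"
  by (simp add: matrix_matrix_mult_def vec_eq_iff sum_negf)

lemma matrix_minus_right: "A ** (- B) = - (A ** (B :: 'a::ring_1^'n^'m))"
  by (simp add: matrix_matrix_mult_def vec_eq_iff sum_negf)

lemma matrix_zero_left [simp]: "0 ** (B :: 'a::ring_1^'n^'m) = 0"
  by (simp add: matrix_matrix_mult_def vec_eq_iff)

lemma matrix_zero_right [simp]: "B ** (0 :: 'a::ring_1^'n^'m) = 0"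
  by (simp add: matrix_matrix_mult_def vec_eq_iff)

lemma mat_scale_mult_left: "mat_scale c A ** B = mat_scale c (A ** B)"
  by (simp add: matrix_matrix_mult_def vec_eq_iff mat_scale_def sum_distrib_left mult.assoc)

lemma mat_scale_mult_right: "A ** mat_scale c B = mat_scale c (A ** B)"
  by (simp add: matrix_matrix_mult_def vec_eq_iff mat_scale_def sum_distrib_left mult.left_commute)

lemma mat_scale_mult_vec: "mat_scale c A *v x = c *s (A *v x)"
  by (simp add: matrix_vector_mult_def vec_eq_iff mat_scale_def sum_distrib_left mult.assoc)

lemma mat_eq_scale: "mat c = mat_scale c (mat 1)"
  by (simp add: mat_def mat_scale_def vec_eq_iff)

lemma mult_mat:
  fixes M :: "complex^'n^'n"
  shows "M ** mat c = mat_scale c M" "mat c ** M = mat_scale c M"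
  by (simp_all add: mat_eq_scale[of c] mat_scale_mult_left mat_scale_mult_right)

lemma matrix_sum_left: "(\<Sum>i\<in>I. f i) ** (B :: 'a::ring_1^'n^'m) = (\<Sum>i\<in>I. f i ** B)"
  by (induction I rule: infinite_finite_induct) (auto simp: matrix_add_rdistrib)

lemma matrix_sum_right: "(B :: 'a::ring_1^'n^'m) ** (\<Sum>i\<in>I. f i) = (\<Sum>i\<in>I. B ** f i)"
  by (induction I rule: infinite_finite_induct) (auto simp: matrix_add_ldistrib)

lemma matrix_sum_vec: "(\<Sum>i\<in>I. f i) *v (x :: 'a::ring_1^'n) = (\<Sum>i\<in>I. f i *v x)"
  by (induction I rule: infinite_finite_induct) (auto simp: matrix_vector_mult_add_rdistrib)

lemma mat_vector_mult: "mat c *v x = c *s (x :: complex^'n)"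
  by (simp add: mat_eq_scale[of c] mat_scale_mult_vec)

lemmas matrix_distribs = matrix_add_ldistrib matrix_add_rdistrib matrix_diff_ldistrib
  matrix_diff_rdistrib matrix_minus_left matrix_minus_right mat_scale_mult_left
  mat_scale_mult_right matrix_mul_assoc

lemmas mat_vec_distribs = matrix_vector_mult_add_rdistrib matrix_vector_mult_diff_rdistrib
  mat_scale_mult_vec matrix_vector_mul_assoc[symmetric] matrix_vector_right_distrib
  matrix_vector_mult_diff_distrib vec.scale

lemma trace_mat_scale: "trace (mat_scale c A) = c * trace A"
  by (simp add: trace_def mat_scale_def sum_distrib_left)

lemma trace_minus: "trace (- A) = - trace (A :: complex^'n^'n)"
  by (simp add: trace_def sum_negf)

lemma trace_mat: "trace (mat c :: complex^'n^'n) = of_nat CARD('n) * c"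
  by (simp add: trace_def mat_def)

lemma trace_sum: "trace (\<Sum>i\<in>I. f i :: complex^'n^'n) = (\<Sum>i\<in>I. trace (f i))"
  unfolding trace_def by (subst sum.swap) simp

lemma trace_transpose: "trace (transpose A) = trace (A :: complex^'n^'n)"
  by (simp add: trace_def transpose_def)

lemmas trace_distribs = trace_add trace_sub trace_mat_scale trace_minus trace_sum

lemma transpose_distribs:
  "transpose (A + B) = transpose A + transpose (B :: complex^'n^'m)"
  "transpose (A - B) = transpose A - transpose (B :: complex^'n^'m)"
  "transpose (- A) = - transpose (A :: complex^'n^'m)"
  "transpose (mat_scale c D) = mat_scale c (transpose D)"
  by (simp_all add: transpose_def vec_eq_iff mat_scale_def)

lemma matrix_eqI_span:
  fixes A C :: "complex^'n^'n"
  assumes "vec.span E = UNIV" "\<And>x. x \<in> E \<Longrightarrow> A *v x = C *v x"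
  shows "A = C"
proof -
  have "A *v x = C *v x" for x
    by (rule vec.linear_eq_on[where B = E]) (use assms in auto)
  then show ?thesis
    by (simp add: matrix_eq)
qed

section \<open>Hermitian geometry\<close>

definition hadj :: "complex^'n^'n \<Rightarrow> complex^'n^'n" where
  "hadj A = (\<chi> i j. cnj (A $ j $ i))"

text \<open>The outer product of \<open>x\<close> with its conjugate. It is an orthogonal projection
  only for unit vectors, whence the recurring assumption \<open>herm x x = 1\<close>; the rank one
  identity \<open>proj_sandwich\<close> holds for every \<open>x\<close>.\<close>

definition proj :: "complex^'n \<Rightarrow> complex^'n^'n" where
  "proj x = (\<chi> i j. x $ i * cnj (x $ j))"

lemma herm_linear_left:
  "herm (x + y) z = herm x z + herm y z" "herm (x - y) z = herm x z - herm y z"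
  "herm (c *s x) z = c * herm x z" "herm 0 z = 0"
  by (simp_all add: herm_def sum.distrib sum_subtractf sum_distrib_left algebra_simps)

lemma herm_linear_right:
  "herm z (x + y) = herm z x + herm z y" "herm z (x - y) = herm z x - herm z y"
  "herm z (c *s x) = cnj c * herm z x" "herm z 0 = 0"
  by (simp_all add: herm_def sum.distrib sum_subtractf sum_distrib_left algebra_simps)

lemma herm_commute: "herm y x = cnj (herm x y)"
  by (simp add: herm_def mult.commute)

lemma herm_self: "herm x x = of_real (\<Sum>i\<in>UNIV. (cmod (x $ i))\<^sup>2)"
  by (simp add: herm_def complex_norm_square[symmetric] del: of_real_power)

lemma herm_eq_0 [simp]: "herm x x = 0 \<longleftrightarrow> x = 0"
  by (simp add: herm_self sum_nonneg_eq_0_iff vec_eq_iff del: of_real_sum)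

lemma herm_mult_cnj: "herm x y * herm y x = of_real ((cmod (herm x y))\<^sup>2)"
  by (simp add: herm_commute[of y x] complex_norm_square[symmetric])

lemma herm_hadj: "herm (A *v x) y = herm x (hadj A *v y)"
proof -
  have "herm (A *v x) y = (\<Sum>i\<in>UNIV. \<Sum>j\<in>UNIV. A $ i $ j * x $ j * cnj (y $ i))"
    by (simp add: herm_def matrix_vector_mult_def sum_distrib_right)
  also have "\<dots> = (\<Sum>j\<in>UNIV. \<Sum>i\<in>UNIV. A $ i $ j * x $ j * cnj (y $ i))"
    by (rule sum.swap)
  also have "\<dots> = herm x (hadj A *v y)"
    by (simp add: herm_def matrix_vector_mult_def hadj_def sum_distrib_left mult_ac)
  finally show ?thesis .
qed

lemma hadj_hadj [simp]: "hadj (hadj A) = A"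
  by (simp add: hadj_def vec_eq_iff)

lemma hadj_mult: "hadj (A ** C) = hadj C ** hadj A"
  by (simp add: hadj_def vec_eq_iff matrix_matrix_mult_def mult.commute)

lemma hadj_distribs:
  "hadj (A + C) = hadj A + hadj C" "hadj (A - C) = hadj A - hadj C"
  "hadj (mat_scale c A) = mat_scale (cnj c) (hadj A)"
  by (simp_all add: hadj_def vec_eq_iff mat_scale_def)

lemma hadj_sum: "hadj (\<Sum>i\<in>I. f i) = (\<Sum>i\<in>I. hadj (f i))"
  by (simp add: hadj_def vec_eq_iff)

lemma trace_hadj: "trace (hadj A) = cnj (trace A)"
  by (simp add: hadj_def trace_def)

lemma trace_mult_hadj: "trace (A ** hadj A) = of_real (\<Sum>i\<in>UNIV. \<Sum>j\<in>UNIV. (cmod (A $ i $ j))\<^sup>2)"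
  by (simp add: hadj_def trace_def matrix_matrix_mult_def complex_norm_square[symmetric] del: of_real_power)

text \<open>A sum of squared moduli vanishes only if all entries do. This norm shows matrices to be
  zero in the intersection of two diagonal algebras, in the uniqueness of components and in the
  design identity.\<close>

lemma trace_mult_hadj_eq_0 [simp]: "trace (A ** hadj A) = 0 \<longleftrightarrow> A = 0"
  by (auto simp: trace_mult_hadj sum_nonneg_eq_0_iff sum_nonneg vec_eq_iff simp del: of_real_sum)

lemma hadj_proj [simp]: "hadj (proj x) = proj x"
  by (simp add: hadj_def proj_def vec_eq_iff)

lemma proj_mult_vec: "proj x *v y = herm y x *s x"
  by (simp add: proj_def herm_def vec_eq_iff matrix_vector_mult_def sum_distrib_left sum_distrib_right mult_ac)

lemma trace_mult_proj: "trace (A ** proj x) = herm (A *v x) x"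
  by (simp add: proj_def herm_def trace_def matrix_matrix_mult_def matrix_vector_mult_def
      sum_distrib_left sum_distrib_right mult_ac)

lemma trace_proj: "trace (proj x) = herm x x"
  by (simp add: proj_def herm_def trace_def)

lemma trace_proj_mult_proj: "trace (proj x ** proj y) = of_real ((cmod (herm x y))\<^sup>2)"
  by (simp only: trace_mult_proj proj_mult_vec herm_linear_left mult.commute[of "herm y x"] herm_mult_cnj[of x y, symmetric])

lemma proj_mult_proj_self: "herm x x = 1 \<Longrightarrow> proj x ** proj x = proj x"
  by (simp add: matrix_eq proj_mult_vec matrix_vector_mul_assoc[symmetric] herm_linear_left)

text \<open>With \<open>proj x\<close> of rank one the middle factor collapses to the number
  \<open>herm (A *v x) x\<close>. This turns the term \<open>P A P\<close> of a double commutator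
  into a trace times \<open>P\<close>.\<close>

lemma proj_sandwich: "proj x ** A ** proj x = mat_scale (trace (A ** proj x)) (proj x)"
  unfolding trace_mult_proj
  by (simp add: matrix_eq proj_mult_vec matrix_vector_mul_assoc[symmetric] herm_linear_left mat_scale_mult_vec vec.scale mult.commute)

lemma orthonormal_basisD:
  fixes E :: "(complex^'n) set"
  assumes "orthonormal_basis E"
  shows "finite E" "card E = CARD('n)" "vec.span E = UNIV"
    "x \<in> E \<Longrightarrow> herm x x = 1" "x \<in> E \<Longrightarrow> y \<in> E \<Longrightarrow> x \<noteq> y \<Longrightarrow> herm x y = 0"
proof -
  have *: "vec.independent E" "vec.span E = UNIV"
    using assms by (auto simp: orthonormal_basis_def)
  show "finite E" using * by (simp add: vec.finiteI_independent)
  show "card E = CARD('n)"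
    using * vec.basis_card_eq_dim[of E UNIV] vec.dimension_def by (simp add: card_cart_basis)
qed (use assms in \<open>auto simp: orthonormal_basis_def\<close>)

lemma sum_proj_onb:
  assumes "orthonormal_basis E"
  shows "(\<Sum>x\<in>E. proj x) = mat 1"
proof (rule matrix_eqI_span[where E = E])
  note E = orthonormal_basisD[OF assms]
  show "vec.span E = UNIV" by fact
  fix y assume y: "y \<in> E"
  have "(\<Sum>x\<in>E. proj x) *v y = (\<Sum>x\<in>E. if x = y then y else 0)"
    unfolding matrix_sum_vec using y E by (intro sum.cong) (auto simp: proj_mult_vec)
  then show "(\<Sum>x\<in>E. proj x) *v y = mat 1 *v y"
    using y E by simp
qed

lemma trace_onb:
  assumes "orthonormal_basis E"
  shows "trace A = (\<Sum>x\<in>E. trace (A ** proj x))"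
  using sum_proj_onb[OF assms] by (metis matrix_mul_rid matrix_sum_right trace_sum)

lemma diagonal_expand:
  assumes "orthonormal_basis E" "\<And>x. x \<in> E \<Longrightarrow> \<exists>c. A *v x = c *s x"
  shows "A = (\<Sum>x\<in>E. mat_scale (trace (A ** proj x)) (proj x))"
proof -
  note E = orthonormal_basisD[OF assms(1)]
  have "A ** proj x = mat_scale (trace (A ** proj x)) (proj x)" if x: "x \<in> E" for x
  proof -
    obtain c where c: "A *v x = c *s x" using assms(2)[OF x] by auto
    have "A ** proj x = mat_scale c (proj x)"
      by (simp add: matrix_eq proj_mult_vec matrix_vector_mul_assoc[symmetric] mat_scale_mult_vec vec.scale c mult.commute)
    then show ?thesis using x E by (simp add: trace_distribs trace_proj)
  qed
  then have "(\<Sum>x\<in>E. A ** proj x) = (\<Sum>x\<in>E. mat_scale (trace (A ** proj x)) (proj x))"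
    by (intro sum.cong) auto
  then show ?thesis
    by (metis sum_proj_onb[OF assms(1)] matrix_mul_rid matrix_sum_right)
qed

definition proj0 :: "complex^'n \<Rightarrow> complex^'n^'n" where
  "proj0 x = proj x - mat (1 / of_nat CARD('n))"

lemma trace_proj0: "herm x x = 1 \<Longrightarrow> trace (proj0 x) = 0"
  by (simp add: proj0_def trace_distribs trace_proj trace_mat)

lemma onb_eigenvector:
  assumes "orthonormal_basis E" "x \<in> E" "y \<in> E"
  shows "proj x *v y = (if x = y then 1 else 0) *s y"
  using orthonormal_basisD[OF assms(1)] assms by (auto simp: proj_mult_vec)

lemma proj0_mem_diagonal_algebra:
  assumes "orthonormal_basis E" "x \<in> E"
  shows "proj0 (x :: complex^'n) \<in> diagonal_algebra E"
proof -
  have "proj0 x *v y = ((if x = y then 1 else 0) - 1 / of_nat CARD('n)) *s y" if "y \<in> E" for y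
    unfolding proj0_def vec.scale_left_diff_distrib onb_eigenvector[OF assms that, symmetric]
    by (simp add: matrix_vector_mult_diff_rdistrib mat_vector_mult)
  moreover have "trace (proj0 x) = 0"
    using orthonormal_basisD(4)[OF assms] by (rule trace_proj0)
  ultimately show ?thesis
    unfolding diagonal_algebra_def sl_def by blast
qed

lemma diagonal_algebra_subset_sl: "diagonal_algebra E \<subseteq> sl"
  by (auto simp: diagonal_algebra_def)

lemma subspace_diagonal_algebra: "mat_vs.subspace (diagonal_algebra E)"
proof -
  have "\<exists>c. (A + C) *v x = c *s x" if "A *v x = a *s x" "C *v x = b *s x" for A C :: "complex^'a^'a" and x a b
    using that by (intro exI[of _ "a + b"]) (simp add: matrix_vector_mult_add_rdistrib vec.scale_left_distrib)
  moreover have "\<exists>d. mat_scale c A *v x = d *s x" if "A *v x = a *s x" for A :: "complex^'a^'a" and x a c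
    using that by (intro exI[of _ "c * a"]) (simp add: mat_scale_mult_vec)
  moreover have "\<exists>c. 0 = c *s x" for x :: "complex^'a"
    by (rule exI[of _ 0]) simp
  ultimately show ?thesis
    unfolding mat_vs.subspace_def diagonal_algebra_def sl_def mem_Collect_eq
    by (simp add: trace_distribs trace_def[of 0]) metis
qed

lemma diagonal_algebra_commute:
  assumes "vec.span E = UNIV" "A \<in> diagonal_algebra E" "C \<in> diagonal_algebra E"
  shows "lie A C = 0"
proof -
  have "A ** C = C ** A"
  proof (rule matrix_eqI_span[OF assms(1)])
    fix x assume "x \<in> E"
    then obtain a where "A *v x = a *s x"
      using assms unfolding diagonal_algebra_def by blast
    moreover obtain c where "C *v x = c *s x"
      using assms \<open>x \<in> E\<close> unfolding diagonal_algebra_def by blast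
    ultimately show "(A ** C) *v x = (C ** A) *v x"
      by (simp add: matrix_vector_mul_assoc[symmetric] vec.scale mult.commute)
  qed
  then show ?thesis by (simp add: lie_def)
qed

text \<open>The projections in the expansion of \<open>A\<close> are Hermitian, so the adjoint only
  conjugates the coefficients. This closure lets the norm \<open>trace (A ** hadj A)\<close> be read
  as a pairing of diagonal algebras, and it later handles conjugate-linear maps.\<close>

lemma hadj_diagonal_algebra:
  assumes "orthonormal_basis E" "A \<in> diagonal_algebra E"
  shows "hadj A \<in> diagonal_algebra E"
proof -
  have "A = (\<Sum>x\<in>E. mat_scale (trace (A ** proj x)) (proj x))"
    using assms by (intro diagonal_expand) (auto simp: diagonal_algebra_def)
  then have "hadj A = (\<Sum>x\<in>E. mat_scale (cnj (trace (A ** proj x))) (proj x))"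
    by (metis (no_types, lifting) hadj_distribs(3) hadj_proj hadj_sum sum.cong)
  moreover have "\<exists>c. (\<Sum>x\<in>E. mat_scale (f x) (proj x)) *v y = c *s y" if y: "y \<in> E" for f y
  proof
    have "(\<Sum>x\<in>E. mat_scale (f x) (proj x)) *v y = (\<Sum>x\<in>E. if x = y then f y *s y else 0)"
      unfolding matrix_sum_vec using y assms
      by (intro sum.cong) (auto simp: mat_scale_mult_vec onb_eigenvector)
    then show "(\<Sum>x\<in>E. mat_scale (f x) (proj x)) *v y = f y *s y"
      using y orthonormal_basisD[OF assms(1)] by simp
  qed
  moreover have "hadj A \<in> sl"
    using assms by (simp add: diagonal_algebra_def sl_def trace_hadj)
  ultimately show ?thesis by (auto simp: diagonal_algebra_def)
qed

text \<open>The algebra is abelian, so its lower central series stops after one step. It is its own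
  normalizer because the commutator of \<open>A\<close> with \<open>proj x\<close>, applied to
  \<open>x\<close>, is \<open>A x\<close> minus its component along \<open>x\<close>; if that is a
  multiple of \<open>x\<close>, so is \<open>A x\<close>.\<close>

lemma cartan_diagonal_algebra:
  assumes E: "orthonormal_basis E"
  shows "cartan_subalgebra (diagonal_algebra E)"
proof -
  let ?H = "diagonal_algebra E"
  have zero: "0 \<in> ?H" using subspace_diagonal_algebra mat_vs.subspace_0 by blast
  have comm: "lie A C = 0" if "A \<in> ?H" "C \<in> ?H" for A C
    using that diagonal_algebra_commute orthonormal_basisD(3)[OF E] by blast
  have "{lie A C | A C. A \<in> ?H \<and> C \<in> ?H} = {0}" using comm[OF zero zero] comm zero by fastforce
  then have "lower_central ?H (Suc 0) = {0}" by simp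
  moreover have "A \<in> ?H" if "A \<in> sl" "\<forall>C\<in>?H. lie A C \<in> ?H" for A
  proof -
    have "\<exists>c. A *v x = c *s x" if x: "x \<in> E" for x
    proof -
      have "lie A (proj0 x) \<in> ?H"
        using that \<open>\<forall>C\<in>?H. lie A C \<in> ?H\<close> proj0_mem_diagonal_algebra[OF E x] by blast
      moreover have "lie A (proj0 x) = lie A (proj x)"
        by (simp add: lie_def proj0_def matrix_distribs mat_eq_scale[of "1 / _"])
      ultimately have "lie A (proj x) \<in> ?H" by simp
      then obtain d where "lie A (proj x) *v x = d *s x"
        using x unfolding diagonal_algebra_def by blast
      then have "A *v x - herm (A *v x) x *s x = d *s x"
        using orthonormal_basisD(4)[OF E x]
        by (simp add: lie_def matrix_vector_mult_diff_rdistrib proj_mult_vec matrix_vector_mul_assoc[symmetric])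
      then have "A *v x = (d + herm (A *v x) x) *s x"
        by (simp add: vec.scale_left_distrib algebra_simps)
      then show ?thesis by blast
    qed
    then show ?thesis using that by (simp add: diagonal_algebra_def)
  qed
  ultimately show ?thesis
    unfolding cartan_subalgebra_def lie_subalgebra_def nilpotent_algebra_def
    using comm zero diagonal_algebra_subset_sl subspace_diagonal_algebra
    by (auto simp del: lower_central.simps dest: subsetD[OF diagonal_algebra_subset_sl])
qed

section \<open>The orthogonal decomposition\<close>

lemma complete_MUBD:
  fixes B :: "nat \<Rightarrow> (complex^'n) set"
  assumes "complete_MUB B"
  shows "i \<le> CARD('n) \<Longrightarrow> orthonormal_basis (B i)"
    "i \<le> CARD('n) \<Longrightarrow> j \<le> CARD('n) \<Longrightarrow> i \<noteq> j \<Longrightarrow> x \<in> B i \<Longrightarrow> y \<in> B j \<Longrightarrow>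
      trace (proj x ** proj y) = 1 / of_nat CARD('n)"
  using assms by (auto simp: complete_MUB_def trace_proj_mult_proj simp del: of_real_power)

lemma trace_sum_mult_sum:
  "trace ((\<Sum>x\<in>I. mat_scale (a x) (f x)) ** (\<Sum>y\<in>J. mat_scale (b y) (g y))) =
    (\<Sum>x\<in>I. \<Sum>y\<in>J. a x * b y * trace (f x ** g y))"
  unfolding matrix_sum_left[of _ I]
  by (simp add: matrix_sum_right trace_sum trace_mat_scale mat_scale_mult_left
        mat_scale_mult_right sum_distrib_left mult_ac)

lemma diagonal_algebra_expand:
  assumes "orthonormal_basis E" "A \<in> diagonal_algebra E"
  shows "A = (\<Sum>x\<in>E. mat_scale (trace (A ** proj x)) (proj x))"
  using assms by (intro diagonal_expand) (auto simp: diagonal_algebra_def)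

text \<open>All mixed traces of projections equal \<open>1/n\<close>, so the double sum factors into
  the product of the traces of \<open>A\<close> and \<open>C\<close>, divided by
  \<open>n\<close>.\<close>

lemma trace_diagonal_eq_0:
  fixes B :: "nat \<Rightarrow> (complex^'n) set"
  assumes B: "complete_MUB B" and ij: "i \<le> CARD('n)" "j \<le> CARD('n)" "i \<noteq> j"
    and "A \<in> diagonal_algebra (B i)" "C \<in> diagonal_algebra (B j)"
  shows "trace (A ** C) = 0"
proof -
  note onb = complete_MUBD(1)[OF B ij(1)] complete_MUBD(1)[OF B ij(2)]
  let ?a = "\<lambda>x. trace (A ** proj x)" and ?c = "\<lambda>x. trace (C ** proj x)"
  have "trace (A ** C) = trace ((\<Sum>x\<in>B i. mat_scale (?a x) (proj x)) ** (\<Sum>y\<in>B j. mat_scale (?c y) (proj y)))"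
    by (intro arg_cong[where f = trace] arg_cong2[where f = "(**)"]
        diagonal_algebra_expand[OF onb(1) assms(5)] diagonal_algebra_expand[OF onb(2) assms(6)])
  also have "\<dots> = (\<Sum>x\<in>B i. \<Sum>y\<in>B j. ?a x * ?c y * trace (proj x ** proj y))"
    by (rule trace_sum_mult_sum)
  also have "\<dots> = (\<Sum>x\<in>B i. \<Sum>y\<in>B j. ?a x * ?c y * (1 / of_nat CARD('n)))"
    by (intro sum.cong refl) (simp add: complete_MUBD(2)[OF B ij])
  also have "\<dots> = trace A * trace C / of_nat CARD('n)"
    unfolding trace_onb[OF onb(1), of A] trace_onb[OF onb(2), of C]
    by (simp add: sum_product sum_divide_distrib)
  also have "trace A = 0" using assms by (simp add: diagonal_algebra_def sl_def)
  finally show ?thesis by simp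
qed

text \<open>The adjoint of \<open>A\<close> lies in the second algebra as well, so orthogonality of
  the two algebras makes the norm of \<open>A\<close> vanish.\<close>

lemma diagonal_algebra_Int_eq_0:
  fixes B :: "nat \<Rightarrow> (complex^'n) set"
  assumes B: "complete_MUB B" and ij: "i \<le> CARD('n)" "j \<le> CARD('n)" "i \<noteq> j"
    and "A \<in> diagonal_algebra (B i)" "A \<in> diagonal_algebra (B j)"
  shows "A = 0"
  using trace_diagonal_eq_0[OF B ij assms(5) hadj_diagonal_algebra[OF _ assms(6)]]
    complete_MUBD(1)[OF B ij(2)] by simp

section \<open>The 2-design identity and the direct sum\<close>

lemma sum_swap_nested:
  "(\<Sum>l\<in>L. \<Sum>i\<in>I. \<Sum>x\<in>X i. g l i x) = (\<Sum>i\<in>I. \<Sum>x\<in>X i. \<Sum>l\<in>L. g l i x)"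
  by (subst sum.swap) (intro sum.cong refl sum.swap)

definition unit_mat :: "'n \<Rightarrow> 'n \<Rightarrow> complex^'n^'n" where
  "unit_mat k l = (\<chi> i j. if i = k \<and> j = l then 1 else 0)"

lemma matrix_unit_expand: "A = (\<Sum>k\<in>UNIV. \<Sum>l\<in>UNIV. mat_scale (A $ k $ l) (unit_mat k l))"
proof -
  have "(\<Sum>k\<in>UNIV. \<Sum>l\<in>UNIV. mat_scale (A $ k $ l) (unit_mat k l)) $ i $ j = A $ i $ j" for i j
  proof -
    have "(\<Sum>k\<in>UNIV. \<Sum>l\<in>UNIV. mat_scale (A $ k $ l) (unit_mat k l)) $ i $ j =
      (\<Sum>k\<in>UNIV. if k = i then \<Sum>l\<in>UNIV. if l = j then A $ k $ l else 0 else 0)"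
      unfolding sum_component
      by (intro sum.cong) (auto simp: mat_scale_def unit_mat_def if_distrib[of "(*) _"] cong: if_cong)
    then show ?thesis by simp
  qed
  then show ?thesis by (simp add: vec_eq_iff)
qed

lemma trace_unit_mat_mult: "trace (unit_mat k l ** A) = A $ l $ k"
proof -
  have "trace (unit_mat k l ** A) = (\<Sum>i\<in>UNIV. \<Sum>j\<in>UNIV. (if i = k then if j = l then A $ j $ i else 0 else 0))"
    unfolding trace_def matrix_matrix_mult_def unit_mat_def
    by (auto intro!: sum.cong)
  also have "\<dots> = (\<Sum>i\<in>UNIV. if i = k then \<Sum>j\<in>UNIV. (if j = l then A $ j $ i else 0) else 0)"
    by (intro sum.cong) auto
  finally show ?thesis by simp
qed

lemma trace_unit_mat: "trace (unit_mat k l) = (if k = l then 1 else 0)"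
  using trace_unit_mat_mult[of k l "mat 1"] by (simp only: matrix_mul_rid) (auto simp: mat_def)

text \<open>The Hilbert--Schmidt norms of the defect \<open>T A = A + tr(A) I - \<Sum> tr(A P) P\<close> add up to zero
  over the unit matrices; this is the equality case that makes \<open>n + 1\<close> bases a projective 2-design.\<close>

lemma MUB_design_norm:
  fixes B :: "nat \<Rightarrow> (complex^'n) set" and A :: "complex^'n^'n"
  assumes B: "complete_MUB B"
  defines "T \<equiv> A + mat (trace A) - (\<Sum>i\<le>CARD('n). \<Sum>x\<in>B i. mat_scale (trace (A ** proj x)) (proj x))"
  shows "trace (T ** hadj T) = trace (A ** hadj A) + trace A * cnj (trace A)
    - (\<Sum>i\<le>CARD('n). \<Sum>x\<in>B i. trace (A ** proj x) * cnj (trace (A ** proj x)))"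
proof -
  define n where "n = (of_nat CARD('n) :: complex)"
  have n: "n \<noteq> 0" by (simp add: n_def)
  define S where "S i = (\<Sum>x\<in>B i. mat_scale (trace (A ** proj x)) (proj x))" for i
  define t where "t = trace A"
  define q where "q i = (\<Sum>x\<in>B i. trace (A ** proj x) * cnj (trace (A ** proj x)))" for i
  define N where "N = {..CARD('n)}"
  have N: "card N = Suc CARD('n)" "finite N" by (simp_all add: N_def)
  have onb: "orthonormal_basis (B i)" if "i \<in> N" for i using complete_MUBD[OF B] that by (simp add: N_def)
  have tS: "trace (S i) = t" if "i \<in> N" for i
    unfolding S_def trace_sum t_def trace_onb[OF onb[OF that], of A]
    using orthonormal_basisD(4)[OF onb[OF that]] by (simp add: trace_mat_scale trace_proj)
  have hS: "hadj (S i) = (\<Sum>x\<in>B i. mat_scale (cnj (trace (A ** proj x))) (proj x))" for i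
    by (simp add: S_def hadj_sum hadj_distribs)
  have AS: "trace (A ** hadj (S i)) = q i" for i
    by (simp add: hS q_def matrix_sum_right trace_sum mat_scale_mult_right trace_mat_scale mult_ac)
  have "trace (S i ** hadj A) = cnj (trace (A ** hadj (S i)))" for i
    by (simp add: hadj_mult flip: trace_hadj)
  then have SA: "trace (S i ** hadj A) = q i" for i
    unfolding AS by (simp add: q_def mult.commute)
  \<comment> \<open>Gram matrix of the components \<open>S i\<close>. Orthonormality leaves the
    diagonal of the double sum when \<open>i = j\<close>; unbiasedness factors it into two sums,
    equal to \<open>t\<close> and its conjugate, when they differ.\<close>
  have SS: "trace (S i ** hadj (S j)) = (if i = j then q i else t * cnj t / n)" if "i \<in> N" "j \<in> N" for i j
  proof -
    have 1: "trace (S i ** hadj (S j)) =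
      (\<Sum>x\<in>B i. \<Sum>y\<in>B j. trace (A ** proj x) * cnj (trace (A ** proj y)) * trace (proj x ** proj y))"
      unfolding hS unfolding S_def by (rule trace_sum_mult_sum)
    show ?thesis
    proof (cases "i = j")
      case True
      have "trace (S i ** hadj (S j)) = (\<Sum>x\<in>B i. \<Sum>y\<in>B i. if x = y then trace (A ** proj x) * cnj (trace (A ** proj y)) else 0)"
        unfolding 1 unfolding True using orthonormal_basisD(4,5)[OF onb[OF that(2)]]
        by (intro sum.cong refl) (auto simp: trace_proj_mult_proj)
      then show ?thesis
        using orthonormal_basisD(1)[OF onb[OF that(1)]] True by (simp add: q_def)
    next
      case False
      have "trace (S i ** hadj (S j)) = (\<Sum>x\<in>B i. \<Sum>y\<in>B j. trace (A ** proj x) * cnj (trace (A ** proj y)) * (1 / n))"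
        unfolding 1 n_def using complete_MUBD(2)[OF B _ _ False] that
        by (intro sum.cong refl) (auto simp: N_def)
      also have "\<dots> = (\<Sum>x\<in>B i. trace (A ** proj x)) * cnj (\<Sum>y\<in>B j. trace (A ** proj y)) / n"
        by (simp add: sum_product sum_divide_distrib)
      also have "\<dots> = t * cnj t / n"
        using trace_onb[OF onb[OF that(1)], of A] trace_onb[OF onb[OF that(2)], of A] by (simp add: t_def)
      finally show ?thesis using False by simp
    qed
  qed
  \<comment> \<open>There are \<open>n (n + 1)\<close> ordered pairs of distinct indices, each
    contributing \<open>t * cnj t / n\<close>.\<close>
  have SSsum: "(\<Sum>i\<in>N. \<Sum>j\<in>N. trace (S i ** hadj (S j))) = (\<Sum>i\<in>N. q i) + (n + 1) * t * cnj t"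
  proof -
    have "(\<Sum>i\<in>N. \<Sum>j\<in>N. trace (S i ** hadj (S j))) =
      (\<Sum>i\<in>N. \<Sum>j\<in>N. t * cnj t / n + (if i = j then q i - t * cnj t / n else 0))"
      by (intro sum.cong refl) (simp add: SS)
    also have "\<dots> = (\<Sum>i\<in>N. (n + 1) * (t * cnj t / n) + (q i - t * cnj t / n))"
      using N by (intro sum.cong refl) (simp add: sum.distrib n_def)
    also have "\<dots> = (\<Sum>i\<in>N. q i) + (n + 1) * ((n + 1) * (t * cnj t / n) - t * cnj t / n)"
      using N by (simp only: sum.distrib sum_subtractf sum_constant) (simp add: n_def algebra_simps)
    also have "(n + 1) * (t * cnj t / n) - t * cnj t / n = t * cnj t"
      using n by (simp add: field_simps)
    finally show ?thesis by simp
  qed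
  have m: "hadj (mat t) = mat (cnj t :: complex)" "X ** mat t = mat_scale t X" "mat t ** X = mat_scale t X"
    for t and X :: "complex^'n^'n"
    by (auto simp: mat_eq_scale[of t] mat_scale_mult_left mat_scale_mult_right)
      (simp_all add: hadj_def mat_def vec_eq_iff mat_scale_def)
  define U where "U = (\<Sum>i\<in>N. S i)"
  have hU: "hadj U = (\<Sum>i\<in>N. hadj (S i))" by (simp add: U_def hadj_sum)
  have trU: "trace U = (n + 1) * t" "trace (hadj U) = (n + 1) * cnj t"
    using tS N by (simp_all add: U_def hU trace_sum trace_hadj n_def)
  have AU: "trace (A ** hadj U) = (\<Sum>i\<in>N. q i)" "trace (U ** hadj A) = (\<Sum>i\<in>N. q i)"
    unfolding hU unfolding U_def
    by (simp_all add: matrix_sum_left matrix_sum_right trace_sum AS SA)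
  have UU: "trace (U ** hadj U) = (\<Sum>i\<in>N. q i) + (n + 1) * t * cnj t"
    unfolding SSsum[symmetric] hU unfolding U_def matrix_sum_left trace_sum
    by (simp add: matrix_sum_right trace_sum)
  have "T = A + mat t - U"
    by (simp add: T_def t_def S_def N_def U_def)
  then have "trace (T ** hadj T) = trace ((A + mat t - U) ** hadj (A + mat t - U))" by simp
  also have "\<dots> = trace (A ** hadj A) + 2 * t * cnj t + n * t * cnj t
     - trace (A ** hadj U) - trace (U ** hadj A) - t * trace (hadj U) - cnj t * trace U
     + trace (U ** hadj U)"
    by (simp add: hadj_distribs m matrix_distribs trace_distribs trace_mat trace_hadj
        t_def[symmetric] n_def[symmetric] algebra_simps)
  \<comment> \<open>The coefficients of \<open>t * cnj t\<close> add up to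
    \<open>(2 + n) - 2 (n + 1) + (n + 1) = 1\<close>, and of the three sums of the
    \<open>q i\<close> one remains with a minus sign.\<close>
  finally show ?thesis
    unfolding trU AU UU by (simp add: t_def[symmetric] q_def[symmetric] N_def[symmetric] algebra_simps)
qed

text \<open>The identity serves twice: for a traceless matrix it displays the components in the
  diagonal algebras, and for arbitrary matrices it shows that the projections of all the bases
  span.\<close>

lemma MUB_design:
  fixes B :: "nat \<Rightarrow> (complex^'n) set" and A :: "complex^'n^'n"
  assumes B: "complete_MUB B"
  shows "A + mat (trace A) = (\<Sum>i\<le>CARD('n). \<Sum>x\<in>B i. mat_scale (trace (A ** proj x)) (proj x))"
proof -
  define T where "T A = A + mat (trace A)
     - (\<Sum>i\<le>CARD('n). \<Sum>x\<in>B i. mat_scale (trace (A ** proj x)) (proj x))" for A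
  let ?E = "unit_mat :: 'n \<Rightarrow> _"
  have hE: "trace (?E k l ** hadj (?E k l)) = 1" for k l
    by (simp add: trace_unit_mat_mult) (simp add: hadj_def unit_mat_def)
  have tE: "trace (?E k l) * cnj (trace (?E k l)) = (if k = l then 1 else 0)" for k l
    by (simp add: trace_unit_mat)
  have proj1: "(\<Sum>k\<in>UNIV. \<Sum>l\<in>UNIV. trace (?E k l ** proj x) * cnj (trace (?E k l ** proj x))) = 1"
    if "herm x x = 1" for x
  proof -
    have "(\<Sum>k\<in>UNIV. \<Sum>l\<in>UNIV. trace (?E k l ** proj x) * cnj (trace (?E k l ** proj x)))
      = (\<Sum>l\<in>UNIV. \<Sum>k\<in>UNIV. proj x $ l $ k * cnj (proj x $ l $ k))"
      unfolding trace_unit_mat_mult by (rule sum.swap)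
    also have "\<dots> = trace (proj x ** hadj (proj x))"
      unfolding trace_mult_hadj by (simp add: complex_norm_square del: of_real_power)
    finally show ?thesis by (simp add: proj_mult_proj_self that trace_proj)
  qed
  \<comment> \<open>The balance is \<open>n^2 + n - n (n + 1) = 0\<close>: every unit matrix has
    norm one, \<open>n\<close> of them have trace one, and each of the \<open>n (n + 1)\<close>
    projections contributes its own norm, which is one.\<close>
  have "(\<Sum>k\<in>UNIV. \<Sum>l\<in>UNIV. trace (T (?E k l) ** hadj (T (?E k l)))) =
    (\<Sum>k\<in>(UNIV :: 'n set). \<Sum>l\<in>(UNIV :: 'n set). 1 + (if k = l then 1 else 0)) - (\<Sum>k\<in>UNIV. \<Sum>l\<in>UNIV. \<Sum>i\<le>CARD('n). \<Sum>x\<in>B i.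
      trace (?E k l ** proj x) * cnj (trace (?E k l ** proj x)))"
    unfolding T_def MUB_design_norm[OF B] hE tE by (simp add: sum_subtractf)
  also have "(\<Sum>k\<in>UNIV. \<Sum>l\<in>UNIV. \<Sum>i\<le>CARD('n). \<Sum>x\<in>B i. trace (?E k l ** proj x) * cnj (trace (?E k l ** proj x))) =
     (\<Sum>k\<in>UNIV. \<Sum>i\<le>CARD('n). \<Sum>x\<in>B i. \<Sum>l\<in>UNIV. trace (?E k l ** proj x) * cnj (trace (?E k l ** proj x)))"
    by (intro sum.cong refl sum_swap_nested)
  also have "\<dots> = (\<Sum>i\<le>CARD('n). \<Sum>x\<in>B i. \<Sum>k\<in>UNIV. \<Sum>l\<in>UNIV. trace (?E k l ** proj x) * cnj (trace (?E k l ** proj x)))"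
    by (rule sum_swap_nested)
  also have "\<dots> = (\<Sum>i\<le>CARD('n). of_nat CARD('n))"
  proof (intro sum.cong refl)
    fix i assume "i \<in> {..CARD('n)}"
    then have "orthonormal_basis (B i)" using complete_MUBD(1)[OF B] by simp
    note E = orthonormal_basisD[OF this]
    show "(\<Sum>x\<in>B i. \<Sum>k\<in>UNIV. \<Sum>l\<in>UNIV.
      trace (?E k l ** proj x) * cnj (trace (?E k l ** proj x))) = of_nat CARD('n)"
      using E by (simp add: proj1)
  qed
  finally have "(\<Sum>k\<in>UNIV. \<Sum>l\<in>UNIV. trace (T (?E k l) ** hadj (T (?E k l)))) = 0"
    by (simp add: sum.distrib algebra_simps)
  then have "T (?E k l) = 0" for k l
    unfolding trace_mult_hadj of_real_sum[symmetric] of_real_eq_0_iff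
    by (simp add: sum_nonneg_eq_0_iff sum_nonneg vec_eq_iff)
  moreover have "T A = (\<Sum>k\<in>UNIV. \<Sum>l\<in>UNIV. mat_scale (A $ k $ l) (T (?E k l)))"
  proof -
    have add: "T (C + D) = T C + T D" for C D
      by (simp add: T_def trace_add matrix_add_rdistrib mat_vs.scale_left_distrib sum.distrib mat_eq_scale[of "_ + _"])
        (simp add: mat_eq_scale[of "trace _"])
    have scale: "T (mat_scale c C) = mat_scale c (T C)" for c C
      by (simp add: T_def trace_mat_scale mat_scale_mult_left mat_vs.scale_right_distrib mat_vs.scale_right_diff_distrib
           mat_vs.scale_sum_right mat_eq_scale[of "_ * _"])
        (simp add: mat_eq_scale[of "trace _"])
    have "T 0 = 0" using scale[of 0 0] by simp
    then have sum: "T (\<Sum>i\<in>I. f i) = (\<Sum>i\<in>I. T (f i))" for I :: "'n set" and f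
      by (induction I rule: infinite_finite_induct) (simp_all add: add)
    show ?thesis by (subst matrix_unit_expand[of A]) (simp add: sum scale)
  qed
  ultimately have "T A = 0" by simp
  then show ?thesis by (simp add: T_def)
qed

lemma MUB_orthogonal_decomposition:
  fixes B :: "nat \<Rightarrow> (complex^'n) set"
  assumes B: "complete_MUB B"
  shows "orthogonal_decomposition (\<lambda>i. diagonal_algebra (B i))"
proof -
  let ?H = "\<lambda>i. diagonal_algebra (B i)"
  have ex: "\<exists>!f. f \<in> PiE {..CARD('n)} ?H \<and> A = (\<Sum>i\<le>CARD('n). f i)" if A: "A \<in> sl" for A
  proof (rule ex_ex1I)
    define f where "f = (\<lambda>i\<in>{..CARD('n)}. \<Sum>x\<in>B i. mat_scale (trace (A ** proj x)) (proj x))"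
    have "f i \<in> ?H i" if i: "i \<le> CARD('n)" for i
    proof -
      note onb = complete_MUBD(1)[OF B i]
      note E = orthonormal_basisD[OF onb]
      \<comment> \<open>The coefficients in one basis sum to the trace of \<open>A\<close>, so each
        projection may be replaced by its traceless part.\<close>
      have "(\<Sum>x\<in>B i. trace (A ** proj x)) = 0"
        using A by (simp flip: trace_onb[OF onb, of A] add: sl_def)
      then have "(\<Sum>x\<in>B i. mat_scale (trace (A ** proj x)) (mat (1 / of_nat CARD('n)))) = 0"
        by (simp flip: mat_vs.scale_sum_left)
      then have "f i = (\<Sum>x\<in>B i. mat_scale (trace (A ** proj x)) (proj0 x))"
        using i by (simp add: f_def proj0_def mat_vs.scale_right_diff_distrib sum_subtractf)
      then show ?thesis
        using proj0_mem_diagonal_algebra[OF onb]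
        by (simp add: mat_vs.subspace_sum mat_vs.subspace_scale subspace_diagonal_algebra)
    qed
    then have "f \<in> PiE {..CARD('n)} ?H"
      by (auto simp: PiE_iff f_def)
    moreover have "A = (\<Sum>i\<le>CARD('n). f i)"
      using MUB_design[OF B, of A] A by (simp add: sl_def f_def mat_eq_scale[of 0])
    ultimately show "\<exists>f. f \<in> PiE {..CARD('n)} ?H \<and> A = (\<Sum>i\<le>CARD('n). f i)"
      by blast
  next
    fix f g
    assume f: "f \<in> PiE {..CARD('n)} ?H \<and> A = (\<Sum>i\<le>CARD('n). f i)"
      and g: "g \<in> PiE {..CARD('n)} ?H \<and> A = (\<Sum>i\<le>CARD('n). g i)"
    have d: "f i - g i \<in> ?H i" if "i \<le> CARD('n)" for i
    proof (rule mat_vs.subspace_diff[OF subspace_diagonal_algebra])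
      show "f i \<in> ?H i" "g i \<in> ?H i"
        using f g that by (auto dest!: PiE_mem[of _ _ _ i])
    qed
    have fg: "(\<Sum>j\<le>CARD('n). f j - g j) = 0"
      unfolding sum_subtractf using f g by (metis diff_self)
    have "f i - g i = 0" if i: "i \<le> CARD('n)" for i
    proof -
      \<comment> \<open>Pairing the zero sum with the adjoint of one of its terms leaves only the
        norm of that term, by orthogonality of different algebras.\<close>
      have "0 = trace ((\<Sum>j\<le>CARD('n). f j - g j) ** hadj (f i - g i))"
        by (simp add: fg trace_def)
      also have "\<dots> = (\<Sum>j\<le>CARD('n). if j = i then trace ((f i - g i) ** hadj (f i - g i)) else 0)"
        unfolding matrix_sum_left trace_sum
        using trace_diagonal_eq_0[OF B _ i _ d hadj_diagonal_algebra[OF complete_MUBD(1)[OF B i] d[OF i]]]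
        by (intro sum.cong refl) auto
      also have "\<dots> = trace ((f i - g i) ** hadj (f i - g i))"
        using i by simp
      finally show ?thesis by simp
    qed
    then have "f i = g i" if "i \<le> CARD('n)" for i using that by simp
    then show "f = g" using f g by (intro PiE_ext[of f "{..CARD('n)}" ?H g]) auto
  qed
  show ?thesis
    unfolding orthogonal_decomposition_def
  proof (intro conjI ballI allI impI)
    show "cartan_subalgebra (?H i)" if "i \<le> CARD('n)" for i
      using cartan_diagonal_algebra complete_MUBD(1)[OF B that] .
  next
    fix i j A C
    assume "i \<le> CARD('n)" "j \<le> CARD('n)" "i \<noteq> j" "A \<in> ?H i" "C \<in> ?H j"
    then show "killing A C = 0"
      by (simp add: killing_def trace_diagonal_eq_0[OF B])
  qed (fact ex)
qed

section \<open>Invariance of the trace form\<close>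

abbreviation mat_linear :: "(complex^'n^'n \<Rightarrow> complex^'n^'n) \<Rightarrow> bool" where
  "mat_linear \<equiv> Vector_Spaces.linear mat_scale mat_scale"

global_interpretation mat_pair: vector_space_pair
  "mat_scale :: complex \<Rightarrow> complex^'n^'n \<Rightarrow> _" "mat_scale :: complex \<Rightarrow> complex^'n^'n \<Rightarrow> _"
  ..

lemma mat_linearI:
  assumes "\<And>A C. f (A + C) = f A + f C" "\<And>c A. f (mat_scale c A) = mat_scale c (f A)"
  shows "mat_linear f"
  using assms by unfold_locales auto

text \<open>The operator trace on the \<open>n^2\<close>-dimensional space of all matrices, in the
  basis of unit matrices. Working there instead of on \<open>sl\<close> keeps a basis with explicit
  entries at hand.\<close>

definition lintrace :: "(complex^'n^'n \<Rightarrow> complex^'n^'n) \<Rightarrow> complex" where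
  "lintrace f = (\<Sum>k\<in>UNIV. \<Sum>l\<in>UNIV. f (unit_mat k l) $ k $ l)"

lemma linear_component:
  assumes "mat_linear f"
  shows "f A $ i $ j = (\<Sum>a\<in>UNIV. \<Sum>b\<in>UNIV. A $ a $ b * f (unit_mat a b) $ i $ j)"
proof -
  have "f A = f (\<Sum>a\<in>UNIV. \<Sum>b\<in>UNIV. mat_scale (A $ a $ b) (unit_mat a b))"
    by (rule arg_cong[OF matrix_unit_expand])
  also have "\<dots> = (\<Sum>a\<in>UNIV. \<Sum>b\<in>UNIV. mat_scale (A $ a $ b) (f (unit_mat a b)))"
    using assms by (simp add: mat_pair.linear_sum mat_pair.linear_scale)
  finally show ?thesis by (simp add: mat_scale_def)
qed

lemma lintrace_commute:
  assumes f: "mat_linear f" and g: "mat_linear g"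
  shows "lintrace (f \<circ> g) = lintrace (g \<circ> f)"
proof -
  let ?F = "\<lambda>k l a b. g (unit_mat k l) $ a $ b * f (unit_mat a b) $ k $ l"
  have "lintrace (f \<circ> g) = (\<Sum>k\<in>UNIV. \<Sum>l\<in>UNIV. \<Sum>a\<in>UNIV. \<Sum>b\<in>UNIV. ?F k l a b)"
    unfolding lintrace_def comp_def
    by (intro sum.cong refl linear_component[OF f])
  also have "\<dots> = (\<Sum>k\<in>UNIV. \<Sum>a\<in>UNIV. \<Sum>b\<in>UNIV. \<Sum>l\<in>UNIV. ?F k l a b)"
    by (intro sum.cong refl sum_swap_nested)
  also have "\<dots> = (\<Sum>a\<in>UNIV. \<Sum>b\<in>UNIV. \<Sum>k\<in>UNIV. \<Sum>l\<in>UNIV. ?F k l a b)"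
    by (rule sum_swap_nested)
  also have "\<dots> = (\<Sum>a\<in>UNIV. \<Sum>b\<in>UNIV. g (f (unit_mat a b)) $ a $ b)"
    by (intro sum.cong refl) (simp add: linear_component[OF g, of "f _"] mult.commute)
  finally show ?thesis by (simp add: lintrace_def)
qed

lemma unit_mat_mult_right: "(A ** unit_mat k l) $ i $ j = (if j = l then A $ i $ k else 0)"
proof -
  have "(A ** unit_mat k l) $ i $ j = (\<Sum>m\<in>UNIV. if m = k then (if j = l then A $ i $ k else 0) else 0)"
    unfolding matrix_matrix_mult_def unit_mat_def vec_lambda_beta by (intro sum.cong refl) auto
  then show ?thesis by simp
qed

lemma unit_mat_mult_left: "(unit_mat k l ** A) $ i $ j = (if i = k then A $ l $ j else 0)"
proof -
  have "(unit_mat k l ** A) $ i $ j = (\<Sum>m\<in>UNIV. if m = l then (if i = k then A $ l $ j else 0) else 0)"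
    unfolding matrix_matrix_mult_def unit_mat_def vec_lambda_beta by (intro sum.cong refl) auto
  then show ?thesis by simp
qed

lemma unit_mat_mult_both: "(A ** unit_mat k l ** C) $ i $ j = A $ i $ k * C $ l $ j"
proof -
  have "(A ** unit_mat k l ** C) $ i $ j = (\<Sum>m\<in>UNIV. if m = l then A $ i $ k * C $ l $ j else 0)"
    unfolding matrix_matrix_mult_def[of _ C] vec_lambda_beta unit_mat_mult_right
    by (intro sum.cong refl) auto
  then show ?thesis by simp
qed

text \<open>The extra term makes scalars orthogonal to everything, as it must since
  \<open>lie (mat c)\<close> vanishes. On traceless matrices the operator trace is the Killing
  form.\<close>

lemma lintrace_lie_lie:
  fixes A C :: "complex^'n^'n"
  shows "lintrace (lie A \<circ> lie C) = killing A C - 2 * trace A * trace C"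
proof -
  have comm: "(lie A (lie C (unit_mat k l))) $ k $ l =
     (A ** C) $ k $ k - A $ k $ k * C $ l $ l - C $ k $ k * A $ l $ l + (C ** A) $ l $ l" for k l
  proof -
    have "lie A (lie C (unit_mat k l)) = (A ** C) ** unit_mat k l - A ** unit_mat k l ** C
       - C ** unit_mat k l ** A + unit_mat k l ** (C ** A)"
      by (simp add: lie_def matrix_distribs algebra_simps)
    then show ?thesis
      by (simp add: unit_mat_mult_both unit_mat_mult_left unit_mat_mult_right)
  qed
  have prod: "(\<Sum>k\<in>UNIV. \<Sum>l\<in>UNIV. M $ k $ k * N $ l $ l) = trace M * trace N" for M N :: "complex^'n^'n"
    by (simp add: trace_def sum_product)
  have "(\<Sum>k\<in>UNIV. \<Sum>l\<in>(UNIV :: 'n set). M $ k $ k) = of_nat CARD('n) * trace M"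
     "(\<Sum>k\<in>(UNIV :: 'n set). \<Sum>l\<in>UNIV. M $ l $ l) = of_nat CARD('n) * trace M" for M :: "complex^'n^'n"
    by (simp_all add: trace_def sum_distrib_left)
  then have "lintrace (lie A \<circ> lie C) = of_nat CARD('n) * trace (A ** C) - trace A * trace C
    - trace C * trace A + of_nat CARD('n) * trace (C ** A)"
    by (simp only: lintrace_def comp_def comm sum.distrib sum_subtractf prod)
  then show ?thesis
    by (simp add: killing_def trace_mul_sym[of C A])
qed

lemma lie_simps:
  "lie (A + D) C = lie A C + lie D C" "lie A (C + D) = lie A C + lie A D"
  "lie (A - D) C = lie A C - lie D C" "lie A (C - D) = lie A C - lie A D"
  "lie (- A) C = - lie A C" "lie A (- C) = - lie A C"
  "lie (mat_scale c A) C = mat_scale c (lie A C)" "lie A (mat_scale c C) = mat_scale c (lie A C)"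
  "lie (mat c) C = 0" "lie A (mat c) = 0"
  by (simp_all add: lie_def matrix_distribs mat_vs.scale_right_diff_distrib mat_eq_scale[of c] algebra_simps)

lemma linear_lie: "mat_linear (lie A)"
  by (rule mat_linearI) (simp_all add: lie_simps)

lemma lie_in_sl [simp]: "lie A C \<in> sl"
  by (simp add: sl_def lie_def trace_sub trace_mul_sym[of A C])

lemma subspace_sl: "mat_vs.subspace sl"
  by (simp add: mat_vs.subspace_def sl_def trace_distribs) (simp add: trace_def)

lemma lie_automorphismsD:
  assumes "\<phi> \<in> lie_automorphisms"
  shows "bij_betw \<phi> sl sl" "A \<in> sl \<Longrightarrow> C \<in> sl \<Longrightarrow> \<phi> (A + C) = \<phi> A + \<phi> C"
    "A \<in> sl \<Longrightarrow> \<phi> (mat_scale c A) = mat_scale c (\<phi> A)"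
    "A \<in> sl \<Longrightarrow> C \<in> sl \<Longrightarrow> \<phi> (lie A C) = lie (\<phi> A) (\<phi> C)" "A \<in> sl \<Longrightarrow> \<phi> A \<in> sl"
    "A \<in> sl \<Longrightarrow> \<phi> (- A) = - \<phi> A" "A \<in> sl \<Longrightarrow> C \<in> sl \<Longrightarrow> \<phi> (A - C) = \<phi> A - \<phi> C"
proof -
  show 1: "bij_betw \<phi> sl sl" and 2: "\<And>A C. A \<in> sl \<Longrightarrow> C \<in> sl \<Longrightarrow> \<phi> (A + C) = \<phi> A + \<phi> C"
    and 3: "\<And>A c. A \<in> sl \<Longrightarrow> \<phi> (mat_scale c A) = mat_scale c (\<phi> A)"
    and "A \<in> sl \<Longrightarrow> C \<in> sl \<Longrightarrow> \<phi> (lie A C) = lie (\<phi> A) (\<phi> C)"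
    using assms by (auto simp: lie_automorphisms_def Bij_def)
  show "A \<in> sl \<Longrightarrow> \<phi> A \<in> sl" using 1 by (auto simp: bij_betw_def)
  have m: "- A = mat_scale (-1) A" for A :: "complex^'n^'n" by simp
  show 4: "\<phi> (- A) = - \<phi> A" if "A \<in> sl" for A unfolding m 3[OF that] ..
  show "A \<in> sl \<Longrightarrow> C \<in> sl \<Longrightarrow> \<phi> (A - C) = \<phi> A - \<phi> C"
    using 2[of A "- C"] 4[of C] mat_vs.subspace_neg[OF subspace_sl, of C] by simp
qed

text \<open>The scalar \<open>s\<close> will be the sign \<open>\<plusminus>1\<close> that separates automorphisms from negatives of
  anti-automorphisms of the matrix algebra.\<close>

definition gl_ext :: "complex \<Rightarrow> (complex^'n^'n \<Rightarrow> complex^'n^'n) \<Rightarrow> complex^'n^'n \<Rightarrow> complex^'n^'n" where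
  "gl_ext s \<phi> A = mat_scale s (\<phi> (A - mat (trace A / of_nat CARD('n)))) + mat (trace A / of_nat CARD('n))"

lemma traceless_part_in_sl [simp]: "(A :: complex^'n^'n) - mat (trace A / of_nat CARD('n)) \<in> sl"
  by (simp add: sl_def trace_sub trace_mat)

lemma mat_zero [simp]: "mat 0 = (0 :: complex^'n^'n)"
  by (simp add: mat_def vec_eq_iff)

lemma gl_ext_sl: "A \<in> sl \<Longrightarrow> gl_ext s \<phi> A = mat_scale s (\<phi> A)"
  by (simp add: gl_ext_def sl_def)

lemma mat_add: "mat (a + b) = mat a + (mat b :: complex^'n^'n)"
  by (simp add: mat_def vec_eq_iff)

lemma mat_mult: "mat (a * b) = mat_scale a (mat b)"
  by (simp add: mat_def vec_eq_iff mat_scale_def)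

context
  fixes \<phi> :: "complex^'n^'n \<Rightarrow> complex^'n^'n" and s :: complex
  assumes aut: "\<phi> \<in> lie_automorphisms"
begin

lemma linear_gl_ext: "mat_linear (gl_ext s \<phi>)"
proof (rule mat_linearI)
  note D = lie_automorphismsD[OF aut]
  fix A C :: "complex^'n^'n" and c
  let ?A = "A - mat (trace A / of_nat CARD('n))" and ?C = "C - mat (trace C / of_nat CARD('n))"
  have "A + C - mat (trace (A + C) / of_nat CARD('n)) = ?A + ?C"
    by (simp add: trace_add add_divide_distrib mat_add)
  then show "gl_ext s \<phi> (A + C) = gl_ext s \<phi> A + gl_ext s \<phi> C"
    unfolding gl_ext_def
    by (simp only: D(2)[OF traceless_part_in_sl traceless_part_in_sl])
      (simp add: mat_vs.scale_right_distrib trace_add add_divide_distrib mat_add)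
  have "mat_scale c A - mat (trace (mat_scale c A) / of_nat CARD('n)) = mat_scale c ?A"
    by (simp add: trace_mat_scale mat_vs.scale_right_diff_distrib mat_mult flip: times_divide_eq_right)
  then show "gl_ext s \<phi> (mat_scale c A) = mat_scale c (gl_ext s \<phi> A)"
    unfolding gl_ext_def
    by (simp only: D(3)[OF traceless_part_in_sl])
      (simp add: mat_vs.scale_right_distrib trace_mat_scale mat_mult mult.commute[of s]
        flip: times_divide_eq_right)
qed

lemma gl_ext_mat: "gl_ext s \<phi> (mat c) = mat c"
proof -
  have "\<phi> 0 = 0"
    using lie_automorphismsD(3)[OF aut, of 0 0] mat_vs.subspace_0[OF subspace_sl] by simp
  then show ?thesis
    by (simp add: gl_ext_def trace_mat)
qed

lemma trace_gl_ext: "trace (gl_ext s \<phi> A) = trace A"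
  using lie_automorphismsD(5)[OF aut traceless_part_in_sl[of A]]
  by (simp add: gl_ext_def trace_distribs trace_mat sl_def)

text \<open>For \<open>s = -1\<close> this is the bracket rule of an anti-homomorphism: if a map
  reverses products, it negates commutators. Scalar parts drop out of every bracket.\<close>

lemma gl_ext_lie:
  assumes "s * s = 1"
  shows "gl_ext s \<phi> (lie A C) = mat_scale s (lie (gl_ext s \<phi> A) (gl_ext s \<phi> C))"
proof -
  let ?A = "A - mat (trace A / of_nat CARD('n))" and ?C = "C - mat (trace C / of_nat CARD('n))"
  have "lie A C = lie ?A ?C" by (simp add: lie_simps)
  then have "gl_ext s \<phi> (lie A C) = mat_scale s (lie (\<phi> ?A) (\<phi> ?C))"
    by (simp add: gl_ext_sl lie_automorphismsD(4)[OF aut])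
  then show ?thesis
    by (simp add: gl_ext_def[of s \<phi> A] gl_ext_def[of s \<phi> C] lie_simps assms)
qed

lemma inj_gl_ext:
  assumes "s \<noteq> 0"
  shows "inj (gl_ext s \<phi>)"
  unfolding mat_pair.linear_inj_iff_eq_0[OF linear_gl_ext]
proof (intro allI impI)
  fix A :: "complex^'n^'n" assume A: "gl_ext s \<phi> A = 0"
  then have "A \<in> sl" using trace_gl_ext[of A] by (simp add: sl_def trace_def)
  with A have "\<phi> A = 0" using assms by (simp add: gl_ext_sl)
  moreover have "\<phi> 0 = 0" "0 \<in> sl"
    using lie_automorphismsD(3)[OF aut, of 0 0] mat_vs.subspace_0[OF subspace_sl] by simp_all
  ultimately show "A = 0"
    using \<open>A \<in> sl\<close> lie_automorphismsD(1)[OF aut] by (metis bij_betw_def inj_onD)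
qed

end

lemma surj_gl_ext:
  fixes \<phi> :: "complex^'n^'n \<Rightarrow> complex^'n^'n"
  assumes aut: "\<phi> \<in> lie_automorphisms"
  shows "surj (gl_ext 1 \<phi>)"
proof -
  have "\<exists>A. gl_ext 1 \<phi> A = C" for C :: "complex^'n^'n"
  proof -
    let ?m = "mat (trace C / of_nat CARD('n))"
    obtain A where A: "A \<in> sl" "\<phi> A = C - ?m"
      using lie_automorphismsD(1)[OF aut] traceless_part_in_sl[of C] unfolding bij_betw_def
      by (metis imageE)
    have "gl_ext 1 \<phi> (A + ?m) = C"
      using A mat_pair.linear_add[OF linear_gl_ext[OF aut, of 1], of A ?m]
      by (simp add: gl_ext_mat[OF aut] gl_ext_sl)
    then show ?thesis ..
  qed
  then show ?thesis unfolding surj_def by metis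
qed

text \<open>\<open>lie (\<phi> A)\<close> is the conjugate of \<open>lie A\<close> by the bijective
  extension of \<open>\<phi>\<close>, so the operator trace of two such maps is unchanged. On
  \<open>sl\<close> this trace is a nonzero multiple of the trace form.\<close>

lemma lie_automorphism_trace_form:
  fixes \<phi> :: "complex^'n^'n \<Rightarrow> complex^'n^'n"
  assumes aut: "\<phi> \<in> lie_automorphisms" and "A \<in> sl" "C \<in> sl"
  shows "trace (\<phi> A ** \<phi> C) = trace (A ** C)"
proof -
  let ?F = "gl_ext 1 \<phi>"
  note lin = linear_gl_ext[OF aut, of 1]
  obtain G where G: "mat_linear G" "G \<circ> ?F = id"
    using mat_pair.linear_injective_left_inverse[OF lin inj_gl_ext[OF aut]] by auto
  have FG: "?F (G M) = M" for M
    using G(2) surj_gl_ext[OF aut] by (metis comp_apply id_apply surjD)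
  have conj: "lie (\<phi> D) M = ?F (lie D (G M))" if "D \<in> sl" for D M
    using gl_ext_lie[OF aut, of 1 D "G M"] that by (simp add: FG gl_ext_sl)
  have GF: "G (?F M) = M" for M
    using G(2) by (simp add: fun_eq_iff)
  have "lie (\<phi> A) \<circ> lie (\<phi> C) = (?F \<circ> lie A) \<circ> (lie C \<circ> G)"
    by (simp add: conj[OF assms(2)] conj[OF assms(3)] fun_eq_iff GF)
  then have "lintrace (lie (\<phi> A) \<circ> lie (\<phi> C)) = lintrace ((lie C \<circ> G) \<circ> (?F \<circ> lie A))"
    using lintrace_commute[OF Vector_Spaces.linear_compose[OF linear_lie lin] Vector_Spaces.linear_compose[OF G(1) linear_lie]]
    by simp
  also have "(lie C \<circ> G) \<circ> (?F \<circ> lie A) = lie C \<circ> lie A"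
    by (simp add: fun_eq_iff GF)
  finally have "killing (\<phi> A) (\<phi> C) = killing C A"
    unfolding lintrace_lie_lie using assms lie_automorphismsD(5)[OF aut] by (simp add: sl_def)
  then show ?thesis by (simp add: killing_def trace_mul_sym[of C A])
qed

text \<open>Scalars and traceless matrices are orthogonal for the trace form. \<open>gl_ext\<close>
  fixes the former, and on the latter the two factors \<open>s\<close> cancel.\<close>

lemma gl_ext_trace_form:
  fixes \<phi> :: "complex^'n^'n \<Rightarrow> complex^'n^'n"
  assumes aut: "\<phi> \<in> lie_automorphisms" and s: "s * s = 1"
  shows "trace (gl_ext s \<phi> A ** gl_ext s \<phi> C) = trace (A ** C)"
proof -
  let ?m = "\<lambda>A :: complex^'n^'n. mat (trace A / of_nat CARD('n))" and ?n = "of_nat CARD('n) :: complex"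
  note mm = mult_mat
  have split: "trace ((M + mat a) ** (N + mat b)) = trace (M ** N) + ?n * a * b"
    if "M \<in> sl" "N \<in> sl" for M N :: "complex^'n^'n" and a b
    using that by (simp add: matrix_distribs mm trace_distribs trace_mat sl_def)
  have sc: "mat_scale s (\<phi> (A - ?m A)) \<in> sl" for A
    by (intro mat_vs.subspace_scale[OF subspace_sl] lie_automorphismsD(5)[OF aut] traceless_part_in_sl)
  have "trace (gl_ext s \<phi> A ** gl_ext s \<phi> C) = trace ((A - ?m A) ** (C - ?m C)) + ?n * (trace A / ?n) * (trace C / ?n)"
    unfolding gl_ext_def split[OF sc sc]
    by (simp add: mat_scale_mult_left mat_scale_mult_right trace_mat_scale
        lie_automorphism_trace_form[OF aut] s flip: mult.assoc)
  also have "\<dots> = trace (((A - ?m A) + ?m A) ** ((C - ?m C) + ?m C))"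
    by (rule split[symmetric]) simp_all
  finally show ?thesis by simp
qed

section \<open>Automorphisms preserving the decomposition\<close>

text \<open>Here \<open>c\<close> lists eigenvalues on an orthonormal basis. Differences in 0, 1, -1
  leave two values \<open>a\<close> and \<open>a + 1\<close>. If \<open>k\<close> entries take the
  larger one, sum zero gives \<open>a = -k/n\<close> and the sum of squares gives
  \<open>k (n - k) = n - 1\<close>, that is \<open>(k - 1) (n - 1 - k) = 0\<close>. The two
  solutions are the two signs.\<close>

lemma two_valued_profile:
  fixes c :: "'a \<Rightarrow> complex"
  assumes "finite C" and n: "card C = n" "n \<ge> 2" and s1: "(\<Sum>y\<in>C. c y) = 0"
    and s2: "(\<Sum>y\<in>C. c y * c y) = 1 - 1 / of_nat n"
    and cubic: "\<And>y z. y \<in> C \<Longrightarrow> z \<in> C \<Longrightarrow> y \<noteq> z \<Longrightarrow> (c y - c z) ^ 3 = c y - c z"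
  shows "\<exists>w\<in>C. (\<forall>y\<in>C. c y = (if y = w then 1 else 0) - 1 / of_nat n) \<or>
    (\<forall>y\<in>C. c y = - ((if y = w then 1 else 0) - 1 / of_nat n))"
proof -
  have n0: "(of_nat n :: complex) \<noteq> 0" using n by simp
  have d: "c y - c z = 0 \<or> c y - c z = 1 \<or> c y - c z = -1" if "y \<in> C" "z \<in> C" for y z
  proof (cases "y = z")
    case False
    let ?d = "c y - c z"
    have "?d * (?d - 1) * (?d + 1) = ?d ^ 3 - ?d" by (simp add: algebra_simps power3_eq_cube)
    also have "\<dots> = 0" using cubic that False by simp
    finally show ?thesis by (auto simp: eq_neg_iff_add_eq_0)
  qed simp
  \<comment> \<open>Without a gap all values would coincide and vanish by \<open>s1\<close>, against
    the nonzero sum of squares.\<close>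
  have "\<exists>y\<in>C. \<exists>z\<in>C. c y - c z = 1"
  proof (rule ccontr)
    assume *: "\<not> ?thesis"
    have eq: "c y = c z" if "y \<in> C" "z \<in> C" for y z
    proof -
      have "c y - c z \<noteq> 1" "c z - c y \<noteq> 1" using * that by auto
      moreover from this have "c y - c z \<noteq> - 1"
        by (metis minus_diff_eq minus_minus)
      ultimately show ?thesis using d[OF that] by simp
    qed
    have "c y = 0" if "y \<in> C" for y
    proof -
      have "(\<Sum>z\<in>C. c z) = (\<Sum>z\<in>C. c y)" by (intro sum.cong refl eq that)
      then show ?thesis using s1 n n0 by simp
    qed
    then have "1 - 1 / of_nat n = (0 :: complex)" using s2 by simp
    then show False using n by simp
  qed
  then obtain y0 z0 where yz: "y0 \<in> C" "z0 \<in> C" "c y0 = c z0 + 1"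
    by (auto simp: algebra_simps)
  define a where "a = c z0"
  define S where "S = {y \<in> C. c y = a + 1}"
  have fS: "finite S" "S \<subseteq> C" using assms by (auto simp: S_def)
  have val: "c y = a + (if y \<in> S then 1 else 0)" if "y \<in> C" for y
  proof -
    \<comment> \<open>The differences to both ends of the gap lie in 0, 1, -1, which excludes
      \<open>a - 1\<close> and \<open>a + 2\<close>.\<close>
    have "c y = a \<or> c y = a + 1"
      using d[OF that yz(2)] d[OF that yz(1)] yz(3) by (auto simp: a_def algebra_simps)
    then show ?thesis using that by (auto simp: S_def)
  qed
  have sumS: "(\<Sum>y\<in>C. if y \<in> S then 1 else 0) = (of_nat (card S) :: complex)"
    using assms(1) fS by (simp add: sum.If_cases Int_absorb1)
  have e1: "of_nat n * a + of_nat (card S) = 0"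
  proof -
    have "(\<Sum>y\<in>C. c y) = (\<Sum>y\<in>C. a + (if y \<in> S then 1 else 0))" using val by (intro sum.cong) auto
    then show ?thesis using s1 n sumS by (simp add: sum.distrib)
  qed
  have e2: "of_nat n * a * a + (2 * a + 1) * of_nat (card S) = 1 - 1 / of_nat n"
  proof -
    have "(\<Sum>y\<in>C. c y * c y) = (\<Sum>y\<in>C. a * a + (2 * a + 1) * (if y \<in> S then 1 else 0))"
      using val by (intro sum.cong) (auto simp: algebra_simps)
    then show ?thesis using s2 n sumS by (simp add: sum.distrib flip: sum_distrib_left)
  qed
  have a: "a = - of_nat (card S) / of_nat n"
    using e1 n0 by (simp add: field_simps add_eq_0_iff)
  have "of_nat (card S) * (of_nat n - of_nat (card S)) = (of_nat n - 1 :: complex)"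
    using e2 n0 unfolding a by (simp add: field_simps)
  then have "of_int (int (card S) * (int n - int (card S))) = (of_int (int n - 1) :: complex)"
    by simp
  then have "int (card S) * (int n - int (card S)) = int n - 1"
    by (simp only: of_int_eq_iff)
  then have "(int (card S) - 1) * (int n - 1 - int (card S)) = 0"
    by (simp add: algebra_simps)
  then consider "card S = 1" | "card S = n - 1" using n by fastforce
  then show ?thesis
  proof cases
    case 1
    then obtain w where "S = {w}" by (auto simp: card_1_singleton_iff)
    then show ?thesis using val fS a 1 by (intro bexI[of _ w]) auto
  next
    case 2
    then have "card (C - S) = 1" using fS n by (simp add: card_Diff_subset)
    then obtain w where w: "C - S = {w}" by (auto simp: card_1_singleton_iff)
    \<comment> \<open>When \<open>k = n - 1\<close>, the majority value is \<open>1/n\<close>, and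
      the exceptional index \<open>w\<close> is the one outside \<open>S\<close>.\<close>
    have "a + 1 = 1 / of_nat n" using n0 n by (simp add: a 2 of_nat_diff field_simps)
    then have "c y = - ((if y = w then 1 else 0) - 1 / of_nat n)" if "y \<in> C" for y
      using val[OF that] w that by (auto simp: algebra_simps)
    then show ?thesis using w by (intro bexI[of _ w]) auto
  qed
qed

section \<open>Images of the traceless projections under an automorphism\<close>

lemma trace_proj0_mult_proj0:
  fixes x y :: "complex^'n"
  assumes "herm x x = 1" "herm y y = 1"
  shows "trace (proj0 x ** proj0 y) = trace (proj x ** proj y) - 1 / of_nat CARD('n)"
  unfolding proj0_def matrix_distribs mat_eq_scale[of "1 / _"] trace_distribs
  by (simp add: trace_mat trace_proj assms)

lemma lie_proj0: "lie (proj0 x) A = lie (proj x) A"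
  by (simp add: proj0_def lie_simps)

text \<open>An idempotent splits the matrices into blocks on which its commutator acts by 0, 1 and
  -1, so that operator is annihilated by \<open>z^3 - z\<close>.\<close>

lemma lie_proj_cubic:
  assumes "herm x x = 1"
  shows "lie (proj x) (lie (proj x) (lie (proj x) A)) = lie (proj x) A"
proof -
  have P: "proj x ** proj x = proj x" "D ** proj x ** proj x = D ** proj x" for D
    using proj_mult_proj_self[OF assms] by (simp_all add: matrix_mul_assoc[symmetric])
  show ?thesis
    unfolding lie_def matrix_distribs P by simp
qed

lemma diagonal_algebra_eigenvector:
  assumes "orthonormal_basis E" "A \<in> diagonal_algebra E" "x \<in> E"
  shows "A *v x = trace (A ** proj x) *s x"
proof -
  obtain c where "A *v x = c *s x" using assms(2,3) unfolding diagonal_algebra_def by blast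
  then show ?thesis
    using orthonormal_basisD(4)[OF assms(1,3)] by (simp add: trace_mult_proj herm_linear_left)
qed

text \<open>The eigenvalues \<open>c\<close> of the image inherit three invariants of
  \<open>proj0 x\<close>: trace, norm and the cubic relation. The sign cannot be fixed at this
  stage, since \<open>A \<mapsto> - A^t\<close> produces the negative one.\<close>

lemma automorphism_proj0:
  fixes \<phi> :: "complex^'n^'n \<Rightarrow> complex^'n^'n"
  assumes n: "CARD('n) \<ge> 2" and aut: "\<phi> \<in> lie_automorphisms"
    and E: "orthonormal_basis E" and C: "orthonormal_basis C"
    and img: "\<phi> ` diagonal_algebra E = diagonal_algebra C" and x: "x \<in> E"
  shows "\<exists>y\<in>C. \<phi> (proj0 x) = proj0 y \<or> \<phi> (proj0 x) = - proj0 y"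
proof -
  note ED = orthonormal_basisD[OF E] and CD = orthonormal_basisD[OF C]
  note D = lie_automorphismsD[OF aut]
  have x1: "herm x x = 1" using ED x by simp
  define h where "h = \<phi> (proj0 x)"
  define c where "c y = trace (h ** proj y)" for y
  have xd: "proj0 x \<in> diagonal_algebra E" by (rule proj0_mem_diagonal_algebra[OF E x])
  then have xs: "proj0 x \<in> sl" using diagonal_algebra_subset_sl by blast
  have h: "h \<in> diagonal_algebra C" using img xd h_def by blast
  have hexp: "h = (\<Sum>y\<in>C. mat_scale (c y) (proj y))"
    unfolding c_def by (rule diagonal_algebra_expand[OF C h])
  have eig: "h *v y = c y *s y" if "y \<in> C" for y
    unfolding c_def by (rule diagonal_algebra_eigenvector[OF C h that])
  have s1: "(\<Sum>y\<in>C. c y) = 0"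
    unfolding c_def trace_onb[OF C, symmetric] using h by (simp add: diagonal_algebra_def sl_def)
  have "(\<Sum>y\<in>C. c y * c y) = (\<Sum>y\<in>C. trace ((h ** h) ** proj y))"
    using CD by (intro sum.cong refl)
      (simp add: trace_mult_proj matrix_vector_mul_assoc[symmetric] eig vec.scale herm_linear_left)
  also have "\<dots> = trace (h ** h)" by (rule trace_onb[OF C, symmetric])
  also have "\<dots> = trace (proj0 x ** proj0 x)"
    unfolding h_def by (rule lie_automorphism_trace_form[OF aut xs xs])
  also have "\<dots> = 1 - 1 / of_nat CARD('n)"
    by (simp add: trace_proj0_mult_proj0 x1 proj_mult_proj_self trace_proj)
  finally have s2: "(\<Sum>y\<in>C. c y * c y) = 1 - 1 / of_nat CARD('n)" .
  have cubic: "(c y - c z) ^ 3 = c y - c z" if y: "y \<in> C" and z: "z \<in> C" and "y \<noteq> z" for y z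
  proof -
    \<comment> \<open>The outer product of \<open>y\<close> with the conjugate of \<open>z\<close>
      is an eigenvector of \<open>lie h\<close> with eigenvalue \<open>c y - c z\<close>. It is
      pulled back along \<open>\<phi>\<close> because the cubic relation is known for
      \<open>proj0 x\<close>.\<close>
    define A :: "complex^'n^'n" where "A = (\<chi> i j. y $ i * cnj (z $ j))"
    have Av: "A *v v = herm v z *s y" for v
      by (simp add: A_def vec_eq_iff matrix_vector_mult_def herm_def sum_distrib_left sum_distrib_right mult_ac)
    have "trace A = herm y z" by (simp add: A_def trace_def herm_def)
    then have "A \<in> sl" using CD(5)[OF that] by (simp add: sl_def)
    then obtain A' where A': "A' \<in> sl" "\<phi> A' = A"
      using D(1) unfolding bij_betw_def by (metis imageE)
    have hA: "lie h A = mat_scale (c y - c z) A"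
    proof (rule matrix_eqI_span[OF CD(3)])
      fix w assume w: "w \<in> C"
      show "lie h A *v w = mat_scale (c y - c z) A *v w"
      proof (cases "w = z")
        case True
        then show ?thesis using y z
          by (simp add: lie_def mat_vec_distribs Av eig herm_linear_left vec.scale_left_diff_distrib CD(4) mult.commute)
      next
        case False
        then show ?thesis using CD(5)[OF w z] w y
          by (simp add: lie_def mat_vec_distribs Av eig herm_linear_left)
      qed
    qed
    have "lie h (lie h (lie h A)) = \<phi> (lie (proj0 x) (lie (proj0 x) (lie (proj0 x) A')))"
      using A' by (simp add: D(4) xs h_def)
    also have "\<dots> = \<phi> (lie (proj0 x) A')"
      unfolding lie_proj0 lie_proj_cubic[OF x1] ..
    also have "\<dots> = lie h A"
      using A' by (simp add: D(4) xs h_def)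
    finally have "mat_scale ((c y - c z) ^ 3) A = mat_scale (c y - c z) A"
      by (simp add: hA lie_simps power3_eq_cube mult.assoc)
    moreover have "A \<noteq> 0"
    proof
      assume "A = 0"
      then have "herm z z *s y = 0" by (simp flip: Av)
      then show False using CD(4)[OF z] CD(4)[OF y] by (simp add: herm_linear_left)
    qed
    ultimately show ?thesis by (metis mat_vs.scale_right_imp_eq)
  qed
  obtain w where w: "w \<in> C" and
    "(\<forall>y\<in>C. c y = (if y = w then 1 else 0) - 1 / of_nat CARD('n)) \<or>
     (\<forall>y\<in>C. c y = - ((if y = w then 1 else 0) - 1 / of_nat CARD('n)))"
    using two_valued_profile[OF CD(1,2) n s1 s2 cubic] by blast
  then consider "\<forall>y\<in>C. c y = (if y = w then 1 else 0) - 1 / of_nat CARD('n)"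
    | "\<forall>y\<in>C. c y = - ((if y = w then 1 else 0) - 1 / of_nat CARD('n))" by blast
  then show ?thesis
  proof cases
    case 1
    have "h = proj0 w"
    proof (rule matrix_eqI_span[OF CD(3)])
      fix y assume y: "y \<in> C"
      then show "h *v y = proj0 w *v y"
        using 1 w by (simp add: eig proj0_def matrix_vector_mult_diff_rdistrib onb_eigenvector[OF C]
            mat_vector_mult vec.scale_left_diff_distrib)
    qed
    then show ?thesis using w h_def by auto
  next
    case 2
    have "h = - proj0 w"
    proof (rule matrix_eqI_span[OF CD(3)])
      fix y assume y: "y \<in> C"
      have "(- proj0 w) *v y = - (proj0 w *v y)"
        using matrix_vector_mult_diff_rdistrib[of 0 "proj0 w" y] by simp
      then show "h *v y = (- proj0 w) *v y"
        using 2 w y by (simp add: eig proj0_def matrix_vector_mult_diff_rdistrib onb_eigenvector[OF C]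
            mat_vector_mult vec.scale_left_diff_distrib)
    qed
    then show ?thesis using w h_def by auto
  qed
qed

section \<open>Uniformity of the sign\<close>

lemma exists_orthogonal_vector:
  fixes a b :: "complex^'n"
  assumes "CARD('n) \<ge> 3"
  shows "\<exists>v. v \<noteq> 0 \<and> herm v a = 0 \<and> herm v b = 0"
proof -
  obtain T :: "'n set" where "card T = 3"
    using obtain_subset_with_card_n[OF assms] by auto
  then obtain i j k :: 'n where ijk: "i \<noteq> j" "i \<noteq> k" "j \<noteq> k"
    by (auto simp: card_3_iff)
  \<comment> \<open>The two orthogonality conditions are the rows \<open>i\<close> and
    \<open>j\<close>. The third index \<open>k\<close> provides a zero row, so the square system is
    singular.\<close>
  define M :: "complex^'n^'n" where
    "M = (\<chi> r s. if r = i then cnj (a $ s) else if r = j then cnj (b $ s) else 0)"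
  have "det M = 0"
    by (rule det_zero_row(1)[of k]) (use ijk in \<open>simp add: M_def row_def vec_eq_iff\<close>)
  then have "\<not> invertible M" by (simp add: invertible_det_nz)
  then obtain v where v: "M *v v = 0" "v \<noteq> 0"
    by (metis invertible_left_inverse matrix_left_invertible_ker)
  have "herm v a = (M *v v) $ i" "herm v b = (M *v v) $ j"
    using ijk by (simp_all add: M_def matrix_vector_mult_def herm_def mult.commute)
  then show ?thesis using v by auto
qed

text \<open>Compare \<open>ad\<^sup>2 P Q - ad\<^sup>2 Q P = 2 tr(P Q) (Q - P)\<close> with its image: on a vector
  orthogonal to both \<open>y\<close> and \<open>y'\<close> only the scalar parts survive.\<close>

lemma mixed_signs:
  fixes \<phi> :: "complex^'n^'n \<Rightarrow> complex^'n^'n"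
  assumes n: "CARD('n) \<ge> 3" and aut: "\<phi> \<in> lie_automorphisms"
    and unit: "herm x x = 1" "herm x' x' = 1" "herm y y = 1" "herm y' y' = 1"
    and xy: "\<phi> (proj0 x) = proj0 y" "\<phi> (proj0 x') = - proj0 y'"
  shows "trace (proj x ** proj x') = 0" "trace (proj y ** proj y') = 2 / of_nat CARD('n)"
proof -
  note D = lie_automorphismsD[OF aut]
  define t where "t z z' = trace (proj z ** proj z')" for z z' :: "complex^'n"
  define L where "L z z' = lie (proj0 z) (lie (proj0 z) (proj0 z'))" for z z' :: "complex^'n"
  have tc: "t z z' = t z' z" for z z' by (simp add: t_def trace_mul_sym[of "proj z"])
  have xs: "proj0 x \<in> sl" "proj0 x' \<in> sl"
    using unit by (simp_all add: sl_def trace_proj0)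
  \<comment> \<open>The trace of the two images is the negative of the trace for \<open>y\<close>
    and \<open>y'\<close>, so the two shifts by \<open>1/n\<close> add up instead of
    cancelling.\<close>
  have sum: "t x x' + t y y' = 2 / of_nat CARD('n)"
    using lie_automorphism_trace_form[OF aut xs] unit
    by (simp add: xy matrix_minus_right trace_minus trace_proj0_mult_proj0 t_def algebra_simps)
  have L: "L z z' = proj z ** proj z' + proj z' ** proj z - mat_scale (2 * t z z') (proj z)"
    if "herm z z = 1" for z z' :: "complex^'n"
  proof -
    have P: "proj z ** proj z = proj z" "M ** proj z ** proj z = M ** proj z" for M
      using proj_mult_proj_self[OF that] by (simp_all add: matrix_mul_assoc[symmetric])
    have "L z z' = lie (proj z) (lie (proj z) (proj z'))"
      by (simp add: L_def lie_proj0) (simp add: proj0_def lie_simps)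
    also have "\<dots> = proj z ** proj z' + proj z' ** proj z - mat_scale 2 (proj z ** proj z' ** proj z)"
      unfolding lie_def matrix_distribs P by (simp add: mat_vs.scale_left_distrib[of 1 1, simplified])
    also have "proj z ** proj z' ** proj z = mat_scale (t z z') (proj z)"
      unfolding proj_sandwich tc[of z z'] by (simp add: t_def)
    finally show ?thesis by simp
  qed
  have "L x x' - L x' x = mat_scale (2 * t x x') (proj0 x' - proj0 x)"
    unfolding L[OF unit(1)] L[OF unit(2)] tc[of x' x]
    by (simp add: proj0_def mat_vs.scale_right_diff_distrib)
  then have "\<phi> (L x x' - L x' x) = \<phi> (mat_scale (2 * t x x') (proj0 x' - proj0 x))"
    by simp
  \<comment> \<open>\<open>L\<close> is quadratic in its first argument and linear in its second, so
    the minus sign at \<open>x'\<close> survives only in the image of \<open>L x x'\<close>.\<close>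
  then have "- L y y' - L y' y = mat_scale (2 * t x x') (- proj0 y' - proj0 y)"
    using xs by (simp add: L_def D xy mat_vs.subspace_diff[OF subspace_sl] lie_simps)
  then have eq: "L y y' + L y' y = mat_scale (2 * t x x') (proj0 y + proj0 y')"
    by (simp add: mat_vs.scale_right_diff_distrib mat_vs.scale_right_distrib algebra_simps)
  obtain v where v: "v \<noteq> 0" "herm v y = 0" "herm v y' = 0"
    using exists_orthogonal_vector[OF n] by blast
  have "(L y y' + L y' y) *v v = 0"
    unfolding L[OF unit(3)] L[OF unit(4)]
    by (simp only: mat_vec_distribs proj_mult_vec v) simp
  moreover have "mat_scale (2 * t x x') (proj0 y + proj0 y') *v v = (- 4 * t x x' / of_nat CARD('n)) *s v"
    by (simp only: mat_vec_distribs proj_mult_vec v proj0_def mat_vector_mult) (simp add: vec_eq_iff)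
  ultimately have "t x x' = 0" using eq v by simp
  then show "trace (proj x ** proj x') = 0" "trace (proj y ** proj y') = 2 / of_nat CARD('n)"
    using sum by (simp_all add: t_def)
qed

lemma MUB_trace_values:
  fixes B :: "nat \<Rightarrow> (complex^'n) set"
  assumes "complete_MUB B" "i \<le> CARD('n)" "j \<le> CARD('n)" "x \<in> B i" "y \<in> B j"
  shows "trace (proj x ** proj y) \<in> {0, 1, 1 / of_nat CARD('n)}"
proof (cases "i = j")
  case True
  then show ?thesis
    using assms orthonormal_basisD(4,5)[OF complete_MUBD(1)[OF assms(1,2)]]
    by (cases "x = y") (auto simp: trace_proj_mult_proj)
next
  case False
  then show ?thesis using complete_MUBD(2)[OF assms(1-3) False assms(4,5)] by simp
qed

definition preserves_decomposition ::
    "(nat \<Rightarrow> (complex^'n) set) \<Rightarrow> (complex^'n^'n \<Rightarrow> complex^'n^'n) \<Rightarrow> bool" where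
  "preserves_decomposition B \<phi> \<longleftrightarrow>
    (\<forall>i\<le>CARD('n). \<exists>j\<le>CARD('n). \<phi> ` diagonal_algebra (B i) = diagonal_algebra (B j))"

text \<open>Opposite signs at two vectors would yield image vectors with trace \<open>2/n\<close>,
  whereas vectors of the given bases only yield 0, 1 or \<open>1/n\<close>; a coincidence forces
  \<open>n = 2\<close>.\<close>

lemma automorphism_sign:
  fixes B :: "nat \<Rightarrow> (complex^'n) set"
  assumes n: "CARD('n) \<ge> 3" and B: "complete_MUB B" and aut: "\<phi> \<in> lie_automorphisms"
  shows "\<exists>s\<in>{1, -1}. \<forall>i\<le>CARD('n). \<forall>j\<le>CARD('n).
    \<phi> ` diagonal_algebra (B i) = diagonal_algebra (B j) \<longrightarrow>
    (\<forall>x\<in>B i. \<exists>y\<in>B j. \<phi> (proj0 x) = mat_scale s (proj0 y))"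
proof -
  define Q where "Q s j x \<longleftrightarrow> (\<exists>y\<in>B j. \<phi> (proj0 x) = mat_scale s (proj0 y))" for s j x
  define R where "R i j x \<longleftrightarrow> i \<le> CARD('n) \<and> j \<le> CARD('n) \<and>
    \<phi> ` diagonal_algebra (B i) = diagonal_algebra (B j) \<and> x \<in> B i" for i j x
  note onb = complete_MUBD(1)[OF B]
  have *: "Q 1 j x \<or> Q (-1) j x" if "R i j x" for i j x
    using automorphism_proj0[OF _ aut onb onb, of i j x] that n by (auto simp: R_def Q_def)
  have contra: False if R: "R i j x" "R i' j' x'" and Q: "Q 1 j x" "Q (-1) j' x'" for i j x i' j' x'
  proof -
    obtain y y' where y: "y \<in> B j" "\<phi> (proj0 x) = proj0 y" "y' \<in> B j'" "\<phi> (proj0 x') = - proj0 y'"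
      using Q by (auto simp: Q_def)
    have unit: "herm z z = 1" if "z \<in> B k" "k \<le> CARD('n)" for z k
      using orthonormal_basisD(4)[OF onb] that by blast
    have "trace (proj y ** proj y') = 2 / of_nat CARD('n)"
      by (rule mixed_signs(2)[OF n aut _ _ _ _ y(2,4)]) (use R y in \<open>auto simp: R_def intro: unit\<close>)
    moreover have "trace (proj y ** proj y') \<in> {0, 1, 1 / of_nat CARD('n)}"
      by (rule MUB_trace_values[OF B]) (use R y in \<open>auto simp: R_def\<close>)
    ultimately have "2 / (of_nat CARD('n) :: complex) \<in> {0, 1, 1 / of_nat CARD('n)}" by simp
    then have "(of_nat 2 :: complex) = of_nat CARD('n)" by (auto simp: field_simps)
    then show False using n unfolding of_nat_eq_iff by simp
  qed
  have "\<exists>s\<in>{1, -1}. \<forall>i j x. R i j x \<longrightarrow> Q s j x"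
  proof (cases "\<forall>i j x. R i j x \<longrightarrow> Q 1 j x")
    case True
    then show ?thesis by blast
  next
    case False
    then obtain i' j' x' where x': "R i' j' x'" "\<not> Q 1 j' x'" by blast
    then have "Q (-1) j' x'" using *[OF x'(1)] by blast
    then have "Q (-1) j x" if "R i j x" for i j x
      using *[OF that] contra[OF that x'(1)] by blast
    then show ?thesis by blast
  qed
  then show ?thesis by (auto simp: R_def Q_def)
qed

text \<open>Twice a product is the Jordan product plus the commutator, and commutators are settled
  by \<open>gl_ext_lie\<close>. For \<open>s = 1\<close> the right-hand side is twice
  \<open>F A ** F C\<close>, for \<open>s = -1\<close> it is twice
  \<open>F C ** F A\<close>.\<close>

lemma gl_ext_multiplicative:
  fixes B :: "nat \<Rightarrow> (complex^'n) set"
  assumes B: "complete_MUB B" and aut: "\<phi> \<in> lie_automorphisms" and s: "s * s = 1"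
    and P: "\<And>i x. i \<le> CARD('n) \<Longrightarrow> x \<in> B i \<Longrightarrow>
      \<exists>y. herm y y = 1 \<and> \<phi> (proj0 x) = mat_scale s (proj0 y)"
  defines "F \<equiv> gl_ext s \<phi>"
  shows "mat_scale 2 (F (A ** C)) = F A ** F C + F C ** F A + mat_scale s (lie (F A) (F C))"
proof -
  note lin = linear_gl_ext[OF aut, of s, folded F_def]
  note [simp] = mat_pair.linear_add[OF lin] mat_pair.linear_scale[OF lin] mat_pair.linear_diff[OF lin]
  \<comment> \<open>For fixed \<open>A\<close>, compatibility with the Jordan product is a linear
    condition on the other factor, so testing it on projections suffices.\<close>
  define J where "J = {C. F (C ** A + A ** C) = F C ** F A + F A ** F C}"
  have "mat_vs.subspace J"
    by (simp add: mat_vs.subspace_def J_def matrix_distribs mat_pair.linear_0[OF lin])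
      (simp add: mat_vs.scale_right_distrib algebra_simps flip: mat_vs.scale_right_distrib)
  have projJ: "proj x \<in> J" if x: "i \<le> CARD('n)" "x \<in> B i" for i x
  proof -
    obtain y where y: "herm y y = 1" "\<phi> (proj0 x) = mat_scale s (proj0 y)" using P[OF x] by blast
    have x1: "herm x x = 1" using orthonormal_basisD(4)[OF complete_MUBD(1)[OF B x(1)] x(2)] .
    \<comment> \<open>The Jordan product with a rank one projection is a double bracket plus a trace
      term. \<open>F\<close> respects both, since the double bracket brings in \<open>s\<close>
      twice.\<close>
    have jordan: "proj z ** M + M ** proj z = lie (proj z) (lie (proj z) M) + mat_scale (2 * trace (M ** proj z)) (proj z)"
      if "herm z z = 1" for z :: "complex^'n" and M
    proof -
      have PP: "proj z ** proj z = proj z" "N ** proj z ** proj z = N ** proj z" for N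
        using proj_mult_proj_self[OF that] by (simp_all add: matrix_mul_assoc[symmetric])
      have "lie (proj z) (lie (proj z) M) = proj z ** M + M ** proj z - mat_scale 2 (proj z ** M ** proj z)"
        unfolding lie_def matrix_distribs PP by (simp add: mat_vs.scale_left_distrib[of 1 1, simplified])
      then show ?thesis by (simp add: proj_sandwich)
    qed
    have "F (proj0 x) = proj0 y"
      using y s trace_proj0[OF x1] by (simp add: F_def gl_ext_sl sl_def)
    then have Fx: "F (proj x) = proj y"
      by (simp add: proj0_def gl_ext_mat[OF aut, of s, folded F_def])
    have tr: "trace (F A ** proj y) = trace (A ** proj x)"
      unfolding Fx[symmetric] unfolding F_def by (rule gl_ext_trace_form[OF aut s])
    have "F (proj x ** A + A ** proj x) = proj y ** F A + F A ** proj y"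
      unfolding jordan[OF x1] jordan[OF y(1)]
      by (simp add: gl_ext_lie[OF aut s, folded F_def] lie_simps Fx tr s)
    then show ?thesis by (simp add: J_def Fx)
  qed
  note m = mult_mat
  have "mat c \<in> J" for c
    by (simp add: J_def m gl_ext_mat[OF aut, of s, folded F_def])
  moreover have "C + mat (trace C) \<in> J"
    unfolding MUB_design[OF B, of C]
    by (intro mat_vs.subspace_sum[OF \<open>mat_vs.subspace J\<close>] mat_vs.subspace_scale[OF \<open>mat_vs.subspace J\<close>])
      (auto intro: projJ)
  ultimately have "C \<in> J"
    using mat_vs.subspace_diff[OF \<open>mat_vs.subspace J\<close>, of "C + mat (trace C)" "mat (trace C)"] by simp
  moreover have "mat_scale 2 (A ** C) = (C ** A + A ** C) + lie A C"
    by (simp add: lie_def mat_vs.scale_left_distrib[of 1 1, simplified])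
  then have "mat_scale 2 (F (A ** C)) = F (C ** A + A ** C) + F (lie A C)"
    by (metis mat_pair.linear_add[OF lin] mat_pair.linear_scale[OF lin])
  ultimately show ?thesis
    by (simp only: J_def mem_Collect_eq gl_ext_lie[OF aut s, folded F_def]) simp
qed

lemma matrix_mult_axis: "A *v axis i 1 = column i (A :: complex^'n^'m)"
  by (simp add: column_def matrix_vector_mult_def axis_def vec_eq_iff if_distrib cong: if_cong)

text \<open>Skolem--Noether: column \<open>i\<close> of the conjugating matrix is the image of a fixed vector under
  \<open>F E\<^sub>i\<^sub>k\<close>.\<close>

lemma mat_algebra_automorphism_inner:
  fixes F :: "complex^'n^'n \<Rightarrow> complex^'n^'n"
  assumes lin: "mat_linear F" and inj: "inj F" and mult: "\<And>A C. F (A ** C) = F A ** F C"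
  shows "\<exists>X. invertible X \<and> (\<forall>A. F A ** X = X ** A)"
proof -
  fix k :: 'n
  have "unit_mat k k $ k $ k \<noteq> (0 :: complex)" by (simp add: unit_mat_def)
  then have "unit_mat k k \<noteq> (0 :: complex^'n^'n)" by force
  then have "F (unit_mat k k) \<noteq> 0"
    using inj mat_pair.linear_0[OF lin] by (metis injD)
  then obtain v where v: "F (unit_mat k k) *v v \<noteq> 0"
    by (metis matrix_eq matrix_vector_mult_0)
  define X :: "complex^'n^'n" where "X = (\<chi> r i. (F (unit_mat i k) *v v) $ r)"
  have X: "X *v u = (\<Sum>i\<in>UNIV. u $ i *s (F (unit_mat i k) *v v))" for u
    by (simp add: X_def vec_eq_iff matrix_vector_mult_def[of "vec_lambda _"] mult.commute)
  have intertwine: "F A ** X = X ** A" for A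
  proof -
    have "F A *v (X *v axis i 1) = X *v (A *v axis i 1)" for i
    proof -
      \<comment> \<open>Column \<open>i\<close> of \<open>A\<close> appears as coefficients of unit
        matrices with the same second index \<open>k\<close>. Under \<open>F\<close> this says that
        \<open>F A\<close> acts on the columns of \<open>X\<close> as \<open>A\<close> acts on the
        standard basis.\<close>
      have "A ** unit_mat i k = (\<Sum>j\<in>UNIV. mat_scale (A $ j $ i) (unit_mat j k))"
        unfolding vec_eq_iff unit_mat_mult_right
        by (auto simp: mat_scale_def unit_mat_def if_distrib cong: if_cong)
      then have "F A ** F (unit_mat i k) = (\<Sum>j\<in>UNIV. mat_scale (A $ j $ i) (F (unit_mat j k)))"
        by (simp add: mat_pair.linear_sum[OF lin] mat_pair.linear_scale[OF lin] flip: mult)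
      then have "F A *v (F (unit_mat i k) *v v) = (\<Sum>j\<in>UNIV. A $ j $ i *s (F (unit_mat j k) *v v))"
        by (simp add: matrix_vector_mul_assoc matrix_sum_vec mat_scale_mult_vec)
      moreover have "(A *v axis i 1) $ j = A $ j $ i" for j
        by (simp add: matrix_mult_axis column_def)
      moreover have "X *v axis i 1 = F (unit_mat i k) *v v"
        by (simp add: matrix_mult_axis column_def X_def vec_eq_iff)
      ultimately show ?thesis by (simp add: X)
    qed
    then have "(F A ** X) *v axis i 1 = (X ** A) *v axis i 1" for i
      by (simp add: matrix_vector_mul_assoc)
    then show ?thesis
      unfolding matrix_mult_axis by (simp add: column_def vec_eq_iff)
  qed
  \<comment> \<open>The kernel of \<open>X\<close> is stable under all matrices. A unit matrix would
    move a nonzero kernel vector to a nonzero multiple of \<open>axis k 1\<close>, whose image under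
    \<open>X\<close> is nonzero by the choice of \<open>v\<close>.\<close>
  have "u = 0" if u: "X *v u = 0" for u
  proof (rule ccontr)
    assume "u \<noteq> 0"
    then obtain i where i: "u $ i \<noteq> 0" by (auto simp: vec_eq_iff)
    have "unit_mat k i *v u = u $ i *s axis k 1"
    proof -
      have "(unit_mat k i *v u) $ r = (\<Sum>j\<in>UNIV. if j = i then (if r = k then u $ i else 0) else 0)" for r
        unfolding unit_mat_def matrix_vector_mult_def vec_lambda_beta by (intro sum.cong refl) auto
      then show ?thesis by (auto simp: vec_eq_iff axis_def)
    qed
    moreover have "X *v (unit_mat k i *v u) = 0"
      using u by (simp add: matrix_vector_mul_assoc flip: intertwine)
        (simp add: matrix_vector_mul_assoc[symmetric])
    ultimately have "X *v axis k 1 = 0" using i by (simp add: vec.scale)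
    moreover have "X *v axis k 1 = F (unit_mat k k) *v v"
      by (simp add: matrix_mult_axis column_def X_def vec_eq_iff)
    ultimately show False using v by simp
  qed
  then have "invertible X"
    unfolding invertible_left_inverse matrix_left_invertible_ker by blast
  then show ?thesis using intertwine by blast
qed

text \<open>An anti-automorphism becomes an automorphism once its values are transposed, so both
  signs reduce to Skolem-Noether. The last conclusion is carried along because the action on
  orthoframes will be read off from the vectors \<open>y\<close>.\<close>

lemma automorphism_form:
  fixes B :: "nat \<Rightarrow> (complex^'n) set"
  assumes n: "CARD('n) \<ge> 3" and B: "complete_MUB B" and aut: "\<phi> \<in> lie_automorphisms"
    and pres: "preserves_decomposition B \<phi>"
  obtains X s where "invertible X" "s \<in> {1, -1}"
    "\<And>A. A \<in> sl \<Longrightarrow> \<phi> A ** X = mat_scale s (X ** (if s = 1 then A else transpose A))"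
    "\<And>i j x. i \<le> CARD('n) \<Longrightarrow> j \<le> CARD('n) \<Longrightarrow> \<phi> ` diagonal_algebra (B i) = diagonal_algebra (B j) \<Longrightarrow>
      x \<in> B i \<Longrightarrow> \<exists>y\<in>B j. \<phi> (proj0 x) = mat_scale s (proj0 y)"
proof -
  obtain s where s: "s \<in> {1, -1}" and "\<forall>i\<le>CARD('n). \<forall>j\<le>CARD('n).
      \<phi> ` diagonal_algebra (B i) = diagonal_algebra (B j) \<longrightarrow>
      (\<forall>x\<in>B i. \<exists>y\<in>B j. \<phi> (proj0 x) = mat_scale s (proj0 y))"
    using automorphism_sign[OF n B aut] by (rule bexE)
  then have Q: "\<exists>y\<in>B j. \<phi> (proj0 x) = mat_scale s (proj0 y)"
    if "i \<le> CARD('n)" "j \<le> CARD('n)" "\<phi> ` diagonal_algebra (B i) = diagonal_algebra (B j)" "x \<in> B i" for i j x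
    using that by simp
  have ss: "s * s = 1" using s by auto
  define F where "F = gl_ext s \<phi>"
  have ex: "\<exists>y. herm y y = 1 \<and> \<phi> (proj0 x) = mat_scale s (proj0 y)" if x: "i \<le> CARD('n)" "x \<in> B i" for i x
  proof -
    obtain j where j: "j \<le> CARD('n)" "\<phi> ` diagonal_algebra (B i) = diagonal_algebra (B j)"
      using pres x unfolding preserves_decomposition_def by blast
    then obtain y where "y \<in> B j" "\<phi> (proj0 x) = mat_scale s (proj0 y)" using Q x by blast
    then show ?thesis using orthonormal_basisD(4)[OF complete_MUBD(1)[OF B j(1)]] by blast
  qed
  have mult: "mat_scale 2 (F (A ** C)) = F A ** F C + F C ** F A + mat_scale s (lie (F A) (F C))" for A C
    unfolding F_def by (rule gl_ext_multiplicative[OF B aut ss ex])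
  have half: "M = N" if "mat_scale 2 M = mat_scale 2 N" for M N :: "complex^'n^'n"
    using that by (simp add: mat_vs.scale_left_imp_eq)
  have two: "mat_scale 2 M = M + M" for M :: "complex^'n^'n"
    by (simp add: mat_vs.scale_left_distrib[of 1 1, simplified])
  have lin: "mat_linear F" and inj: "inj F"
    using linear_gl_ext[OF aut] inj_gl_ext[OF aut, of s] s by (auto simp: F_def)
  have Fsl: "\<phi> A = mat_scale s (F A)" if "A \<in> sl" for A
    using that ss by (simp add: F_def gl_ext_sl)
  from s consider "s = 1" | "s = -1" by blast
  then show ?thesis
  proof cases
    case 1
    have "F (A ** C) = F A ** F C" for A C
      by (rule half) (simp add: mult, simp add: 1 lie_def two)
    from mat_algebra_automorphism_inner[OF lin inj this] obtain X where
      X: "invertible X" "\<And>A. F A ** X = X ** A" by blast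
    show ?thesis
      by (rule that[OF X(1) s _ Q]) (auto simp: Fsl 1 X)
  next
    case 2
    have anti: "F (A ** C) = F C ** F A" for A C
      by (rule half) (simp add: mult, simp add: 2 lie_def two)
    let ?G = "\<lambda>A. transpose (F A)"
    have "mat_linear ?G"
      by (rule mat_linearI) (simp_all add: mat_pair.linear_add[OF lin] mat_pair.linear_scale[OF lin] transpose_distribs)
    moreover have "inj ?G" using inj by (auto simp: inj_def)
    moreover have "?G (A ** C) = ?G A ** ?G C" for A C
      by (simp add: anti matrix_transpose_mul)
    ultimately obtain X where X: "invertible X" "\<And>A. transpose (F A) ** X = X ** A"
      using mat_algebra_automorphism_inner[of ?G] by blast
    obtain Y where Y: "X ** Y = mat 1" "Y ** X = mat 1"
      using X(1) unfolding invertible_def by blast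
    have Yt: "transpose Y ** transpose X = mat 1" "transpose X ** transpose Y = mat 1"
      using Y by (simp_all flip: matrix_transpose_mul)
    \<comment> \<open>If \<open>X\<close> implements the transposed map, then the inverse transpose
      of \<open>X\<close> implements \<open>F\<close> itself.\<close>
    have "F A ** transpose Y = transpose Y ** transpose A" for A
    proof -
      have "transpose X ** F A = transpose A ** transpose X"
        using arg_cong[OF X(2)[of A], of transpose] by (simp add: matrix_transpose_mul)
      then have eq: "transpose Y ** (transpose X ** F A) ** transpose Y = transpose Y ** (transpose A ** transpose X) ** transpose Y"
        by simp
      have "transpose Y ** (transpose X ** F A) ** transpose Y = F A ** transpose Y"
        by (simp add: matrix_mul_assoc Yt)
      moreover have "transpose Y ** (transpose A ** transpose X) ** transpose Y = transpose Y ** transpose A"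
        by (simp add: Yt flip: matrix_mul_assoc)
      ultimately show ?thesis using eq by simp
    qed
    moreover have "invertible (transpose Y)"
      unfolding invertible_def using Yt by blast
    ultimately show ?thesis
      by (intro that[OF _ s _ Q, of "transpose Y"]) (auto simp: Fsl 2 matrix_minus_left)
  qed
qed

section \<open>Semilinear maps\<close>

text \<open>Normal form of the elements of \<open>GL_plus\<close>; the flag \<open>b\<close> records
  whether \<tau> is applied before the matrix. Products return to this form since \<tau> passes a
  matrix by conjugating its entries.\<close>

definition semi :: "bool \<Rightarrow> complex^'n^'n \<Rightarrow> complex^'n \<Rightarrow> complex^'n" where
  "semi b X x = X *v (if b then conjugation x else x)"

definition cnj_mat :: "complex^'n^'n \<Rightarrow> complex^'n^'n" where
  "cnj_mat A = (\<chi> i j. cnj (A $ i $ j))"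

lemma conjugation_conjugation [simp]: "conjugation (conjugation x) = x"
  by (simp add: conjugation_def vec_eq_iff)

lemma conjugation_scale: "conjugation (c *s x) = cnj c *s conjugation x"
  by (simp add: conjugation_def vec_eq_iff)

lemma conjugation_eq_0 [simp]: "conjugation x = 0 \<longleftrightarrow> x = 0"
  by (simp add: conjugation_def vec_eq_iff)

lemma conjugation_0 [simp]: "conjugation 0 = 0"
  by simp

lemma bij_conjugation: "bij conjugation"
  by (rule o_bij[of conjugation]) (simp_all add: fun_eq_iff)

lemma conjugation_mult_vec: "conjugation (A *v x) = cnj_mat A *v conjugation x"
  by (simp add: conjugation_def vec_eq_iff cnj_mat_def matrix_vector_mult_def)

lemma herm_conjugation: "herm (conjugation x) (conjugation y) = cnj (herm x y)"
  by (simp add: herm_def conjugation_def)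

lemma cnj_mat_simps [simp]:
  "cnj_mat (cnj_mat A) = A" "cnj_mat (mat c) = mat (cnj c)" "cnj_mat (A ** C) = cnj_mat A ** cnj_mat C"
  by (auto simp: cnj_mat_def vec_eq_iff mat_def matrix_matrix_mult_def)

lemma transpose_eq_cnj_hadj: "transpose A = cnj_mat (hadj A)"
  by (simp add: transpose_def cnj_mat_def hadj_def)

lemma matrix_inv_right_left:
  fixes X :: "complex^'n^'n"
  assumes "invertible X"
  shows "X ** matrix_inv X = mat 1" "matrix_inv X ** X = mat 1"
  using someI_ex[OF assms[unfolded invertible_def]] unfolding matrix_inv_def by auto

lemma invertible_cancel_right:
  fixes X :: "complex^'n^'n"
  assumes "invertible X"
  shows "M ** X = N ** X \<longleftrightarrow> M = N"
  by (metis assms matrix_inv_right_left(1) matrix_mul_assoc matrix_mul_rid)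

lemma invertible_cancel_left:
  fixes X :: "complex^'n^'n"
  assumes "invertible X"
  shows "X ** M = X ** N \<longleftrightarrow> M = N"
  by (metis assms matrix_inv_right_left(2) matrix_mul_assoc matrix_mul_lid)

lemma invertible_cnj_mat: "invertible X \<Longrightarrow> invertible (cnj_mat X)"
  unfolding invertible_def by (metis cnj_mat_simps(2,3) complex_cnj_one)

lemma semi_compose:
  "semi b X \<circ> semi c Y = semi (b \<noteq> c) (X ** (if b then cnj_mat Y else Y))"
  by (auto simp: fun_eq_iff semi_def conjugation_mult_vec matrix_vector_mul_assoc)

lemma semi_scale: "semi b X (c *s x) = (if b then cnj c else c) *s semi b X x"
  by (simp add: semi_def conjugation_scale vec.scale)

lemma semi_eq_0:
  assumes "invertible X"
  shows "semi b X x = 0 \<longleftrightarrow> x = 0"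
  using assms unfolding invertible_left_inverse matrix_left_invertible_ker
  by (auto simp: semi_def)

lemma semi_id: "semi False (mat 1) = id"
  by (simp add: semi_def fun_eq_iff)

lemma semi_inverse:
  assumes "invertible X"
  shows "\<exists>Y. invertible Y \<and> semi b Y \<circ> semi b X = id \<and> semi b X \<circ> semi b Y = id"
proof -
  obtain Y where Y: "X ** Y = mat 1" "Y ** X = mat 1" "invertible Y"
    using assms unfolding invertible_def by blast
  show ?thesis
  proof (cases b)
    case False
    then show ?thesis using Y by (intro exI[of _ Y]) (simp add: semi_compose semi_id)
  next
    case True
    have "cnj_mat Y ** cnj_mat X = mat 1" "X ** Y = mat 1"
      using Y by (simp_all flip: cnj_mat_simps(3))
    then show ?thesis using Y True
      by (intro exI[of _ "cnj_mat Y"]) (simp add: semi_compose semi_id invertible_cnj_mat)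
  qed
qed

lemma bij_semi: "invertible X \<Longrightarrow> bij (semi b X)"
  using semi_inverse[of X b] o_bij by blast

lemma matrix_semi: "matrix (semi b X) = (X :: complex^'n^'n)"
proof -
  have "conjugation (axis j 1) = axis j 1" for j :: 'n
    by (simp add: conjugation_def vec_eq_iff axis_def)
  then have "semi b X (axis j 1) $ i = X $ i $ j" for i j
    by (simp add: semi_def matrix_mult_axis column_def)
  then show ?thesis
    by (simp add: matrix_def vec_eq_iff)
qed

lemma semi_in_GL_maps:
  assumes "invertible (X :: complex^'n^'n)"
  shows "semi b X \<in> GL_maps \<longleftrightarrow> \<not> b"
proof
  assume "semi b X \<in> GL_maps"
  then obtain Y where Y: "semi b X = (*v) Y" by (auto simp: GL_maps_def)
  fix i :: 'n
  let ?e = "axis i 1 :: complex^'n"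
  \<comment> \<open>The imaginary unit separates the two cases: a conjugate-linear map would turn it
    into its negative.\<close>
  have "semi b X (\<i> *s ?e) = \<i> *s semi b X ?e"
    by (simp add: Y vec.scale)
  moreover have "semi b X ?e \<noteq> 0" using semi_eq_0[OF assms] by (simp add: axis_eq_0_iff)
  ultimately show "\<not> b"
    by (auto simp: semi_scale vec.scale_left_imp_eq dest: vec.scale_right_imp_eq)
next
  assume "\<not> b"
  then have "semi b X = (*v) X" by (simp add: semi_def fun_eq_iff)
  then show "semi b X \<in> GL_maps" using assms by (auto simp: GL_maps_def)
qed

lemma BijGroup_UNIV_simps:
  "carrier (BijGroup UNIV) = {f. bij f}" "\<one>\<^bsub>BijGroup UNIV\<^esub> = id"
  "f \<in> {f. bij f} \<Longrightarrow> g \<in> {f. bij f} \<Longrightarrow> f \<otimes>\<^bsub>BijGroup UNIV\<^esub> g = f \<circ> g"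
  by (auto simp: BijGroup_def Bij_def compose_def fun_eq_iff)

lemma conjugation_semi: "conjugation = semi True (mat 1)"
  by (simp add: semi_def fun_eq_iff)

lemma GL_generators: "insert conjugation GL_maps \<subseteq> {semi b X | b X. invertible X}"
proof -
  have "(*v) X = semi False X" for X :: "complex^'n^'n" by (simp add: semi_def fun_eq_iff)
  then show ?thesis
    unfolding conjugation_semi GL_maps_def using invertible_def[of "mat 1"] by auto
qed

lemma carrier_GL_plus: "carrier (GL_plus :: (complex^'n \<Rightarrow> complex^'n) monoid) = {semi b X | b X. invertible X}"
proof (intro equalityI subsetI)
  let ?G = "BijGroup (UNIV :: (complex^'n) set)"
  interpret group ?G by (rule group_BijGroup)
  fix f assume "f \<in> carrier (GL_plus :: (complex^'n \<Rightarrow> complex^'n) monoid)"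
  then have "f \<in> generate ?G (insert conjugation GL_maps)" by (simp add: GL_plus_def)
  then show "f \<in> {semi b X | b X. invertible X}"
  proof induction
    case one
    have "id = semi False (mat 1 :: complex^'n^'n)" by (simp add: semi_id)
    moreover have "invertible (mat 1 :: complex^'n^'n)" by (auto simp: invertible_def)
    ultimately show ?case unfolding BijGroup_UNIV_simps by blast
  next
    case (incl h)
    then show ?case using GL_generators by blast
  next
    case (inv h)
    then obtain b X where h: "h = semi b X" "invertible X" using GL_generators by blast
    obtain Y where Y: "invertible Y" "semi b Y \<circ> semi b X = id"
      using semi_inverse[OF h(2)] by blast
    have "inv\<^bsub>?G\<^esub> h = semi b Y"
      by (rule inv_equality) (use Y h in \<open>simp_all add: BijGroup_UNIV_simps bij_semi\<close>)
    then show ?case using Y by blast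
  next
    case (eng h1 h2)
    then obtain b X c Y where h: "h1 = semi b X" "invertible X" "h2 = semi c Y" "invertible Y" by blast
    then have "h1 \<otimes>\<^bsub>?G\<^esub> h2 = semi (b \<noteq> c) (X ** (if b then cnj_mat Y else Y))"
      by (simp add: BijGroup_UNIV_simps bij_semi semi_compose)
    moreover have "invertible (X ** (if b then cnj_mat Y else Y))"
      using h by (simp add: invertible_mult invertible_cnj_mat)
    ultimately show ?case by blast
  qed
next
  let ?G = "BijGroup (UNIV :: (complex^'n) set)"
  fix f :: "complex^'n \<Rightarrow> complex^'n" assume "f \<in> {semi b X | b X. invertible X}"
  then obtain b X where f: "f = semi b X" "invertible X" by blast
  have 1: "semi False X \<in> generate ?G (insert conjugation GL_maps)"
    by (rule generate.incl) (simp add: semi_in_GL_maps f)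
  have "semi True X = semi False X \<circ> conjugation"
    by (simp add: fun_eq_iff semi_def)
  also have "\<dots> = semi False X \<otimes>\<^bsub>?G\<^esub> conjugation"
    by (simp add: BijGroup_UNIV_simps bij_semi[OF f(2)] bij_conjugation)
  finally have "semi True X = semi False X \<otimes>\<^bsub>?G\<^esub> conjugation" .
  then have "semi True X \<in> generate ?G (insert conjugation GL_maps)"
    using generate.eng[OF 1 generate.incl] by simp
  then show "f \<in> carrier GL_plus"
    using 1 f by (cases b) (simp_all add: GL_plus_def)
qed

lemma GL_plus_simps:
  "\<one>\<^bsub>GL_plus\<^esub> = id"
  "f \<in> carrier GL_plus \<Longrightarrow> g \<in> carrier GL_plus \<Longrightarrow> f \<otimes>\<^bsub>GL_plus\<^esub> g = f \<circ> g"
  by (auto simp: GL_plus_def BijGroup_UNIV_simps)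
    (auto simp: BijGroup_UNIV_simps bij_semi carrier_GL_plus[unfolded GL_plus_def, simplified])

lemma group_GL_plus: "group (GL_plus :: (complex^'n \<Rightarrow> complex^'n) monoid)"
proof -
  interpret group "BijGroup (UNIV :: (complex^'n) set)" by (rule group_BijGroup)
  have "insert conjugation GL_maps \<subseteq> carrier (BijGroup (UNIV :: (complex^'n) set))"
  proof
    fix f assume "f \<in> insert conjugation (GL_maps :: (complex^'n \<Rightarrow> complex^'n) set)"
    then obtain b X where "f = semi b X" "invertible X" using GL_generators by blast
    then show "f \<in> carrier (BijGroup UNIV)" by (simp add: BijGroup_UNIV_simps bij_semi)
  qed
  from generate_is_subgroup[OF this] show ?thesis
    unfolding GL_plus_def by (rule subgroup.subgroup_is_group) (rule group_axioms)
qed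

section \<open>Maps permuting the orthoframes\<close>

lemma semi_image_line:
  assumes "semi b X x = c *s y" "c \<noteq> 0"
  shows "semi b X ` vec.span {x} = vec.span {y}"
proof -
  have "semi b X ` vec.span {x} = (\<lambda>k. (if b then cnj k else k) *s (c *s y)) ` UNIV"
    unfolding vec.span_singleton image_image semi_scale assms(1) ..
  also have "\<dots> = vec.span {y}"
    unfolding vec.span_singleton
  proof (intro equalityI subsetI)
    fix v assume "v \<in> range (\<lambda>k. k *s y)"
    then obtain k where "v = k *s y" by blast
    then have "v = (\<lambda>k. (if b then cnj k else k) *s (c *s y)) (if b then cnj (k / c) else k / c)"
      using assms(2) by simp
    then show "v \<in> range (\<lambda>k. (if b then cnj k else k) *s (c *s y))" by blast
  qed auto
  finally show ?thesis .
qed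

lemma semi_image_lineD:
  assumes X: "invertible X" and "semi b X ` vec.span {x} = vec.span {y}" "x \<noteq> 0"
  shows "\<exists>c. c \<noteq> 0 \<and> semi b X x = c *s y"
proof -
  have "semi b X x \<in> vec.span {y}" using assms(2) vec.span_base[of x "{x}"] by blast
  then obtain c where c: "semi b X x = c *s y" unfolding vec.span_singleton by blast
  then have "c \<noteq> 0" using assms(3) semi_eq_0[OF X, of b x] by auto
  then show ?thesis using c by blast
qed

lemma onb_nonzero: "orthonormal_basis E \<Longrightarrow> x \<in> E \<Longrightarrow> x \<noteq> 0"
  using orthonormal_basisD(4)[of E x] by (auto simp: herm_linear_left)

lemma inj_on_line:
  assumes E: "orthonormal_basis E"
  shows "inj_on (\<lambda>x. vec.span {x}) E"
proof (rule inj_onI, rule ccontr)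
  fix x y assume xy: "x \<in> E" "y \<in> E" "vec.span {x} = vec.span {y}" "x \<noteq> y"
  then have "x \<in> vec.span {y}" using vec.span_base[of x "{x}"] by blast
  then obtain c where "x = c *s y" unfolding vec.span_singleton by blast
  then have "herm x x = c * cnj c * herm y y" "herm x y = c * herm y y" by (simp_all add: herm_linear_left herm_linear_right)
  then show False using orthonormal_basisD(4,5)[OF E] xy by simp
qed

lemma Ort_finite_card:
  assumes E: "orthonormal_basis (E :: (complex^'n) set)"
  shows "finite (Ort E)" "card (Ort E) = CARD('n)"
proof -
  have "Ort E = (\<lambda>x. vec.span {x}) ` E" by (auto simp: Ort_def)
  then show "finite (Ort E)" "card (Ort E) = CARD('n)"
    using orthonormal_basisD(1,2)[OF E] card_image[OF inj_on_line[OF E]] by simp_all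
qed

text \<open>The preimage in \<open>GL_plus\<close> of the carrier of \<open>Aut_MUB\<close>. Maps
  replace cosets here because \<open>Ad\<close> is defined on maps; \<open>Aut_MUB_eq\<close>
  performs the passage to the quotient.\<close>

definition frame_maps :: "(nat \<Rightarrow> (complex^'n) set) \<Rightarrow> (complex^'n \<Rightarrow> complex^'n) set" where
  "frame_maps B = {f \<in> carrier GL_plus.
    \<forall>i\<le>CARD('n). \<exists>j\<le>CARD('n). (`) f ` Ort (B i) = Ort (B j)}"

lemma frame_mapsE:
  fixes B :: "nat \<Rightarrow> (complex^'n) set"
  assumes "f \<in> frame_maps B"
  obtains b X where "f = semi b X" "invertible X"
    "\<And>i. i \<le> CARD('n) \<Longrightarrow> \<exists>j\<le>CARD('n). (`) (semi b X) ` Ort (B i) = Ort (B j)"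
  using assms unfolding frame_maps_def carrier_GL_plus by blast

lemma frame_image:
  assumes X: "invertible X" and img: "(`) (semi b X) ` Ort E = Ort C" and E: "orthonormal_basis E"
  shows "x \<in> E \<Longrightarrow> \<exists>y\<in>C. \<exists>c. c \<noteq> 0 \<and> semi b X x = c *s y"
    "y \<in> C \<Longrightarrow> \<exists>x\<in>E. \<exists>c. c \<noteq> 0 \<and> semi b X x = c *s y"
proof -
  assume x: "x \<in> E"
  then have "vec.span {x} \<in> Ort E" by (auto simp: Ort_def)
  then have "semi b X ` vec.span {x} \<in> Ort C" unfolding img[symmetric] by (rule imageI)
  then obtain y where "y \<in> C" "semi b X ` vec.span {x} = vec.span {y}" by (auto simp: Ort_def)
  then show "\<exists>y\<in>C. \<exists>c. c \<noteq> 0 \<and> semi b X x = c *s y"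
    using semi_image_lineD[OF X _ onb_nonzero[OF E x]] by blast
next
  assume y: "y \<in> C"
  then have "vec.span {y} \<in> Ort C" by (auto simp: Ort_def)
  then obtain x where x: "x \<in> E" "semi b X ` vec.span {x} = vec.span {y}"
    unfolding img[symmetric] by (auto simp: Ort_def)
  then show "\<exists>x\<in>E. \<exists>c. c \<noteq> 0 \<and> semi b X x = c *s y"
    using semi_image_lineD[OF X _ onb_nonzero[OF E]] by blast
qed

text \<open>The traceless part of \<open>A\<close> lies in the diagonal algebras of
  \<open>B 0\<close> and \<open>B 1\<close>, which meet only in zero.\<close>

lemma scalar_if_diagonal_twice:
  fixes B :: "nat \<Rightarrow> (complex^'n) set"
  assumes B: "complete_MUB B"
    and "\<And>i x. i \<le> CARD('n) \<Longrightarrow> x \<in> B i \<Longrightarrow> \<exists>c. A *v x = c *s x"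
  shows "\<exists>c. A = mat c"
proof -
  let ?c = "trace A / of_nat CARD('n)"
  have "A - mat ?c \<in> diagonal_algebra (B i)" if "i \<le> CARD('n)" for i
  proof -
    have "\<exists>c. (A - mat ?c) *v x = c *s x" if "x \<in> B i" for x
    proof -
      obtain c where "A *v x = c *s x" using assms(2)[OF \<open>i \<le> CARD('n)\<close> \<open>x \<in> B i\<close>] by blast
      then have "(A - mat ?c) *v x = (c - ?c) *s x"
        by (simp add: matrix_vector_mult_diff_rdistrib mat_vector_mult vec.scale_left_diff_distrib)
      then show ?thesis by blast
    qed
    then show ?thesis by (simp add: diagonal_algebra_def)
  qed
  from diagonal_algebra_Int_eq_0[OF B _ _ _ this[of 0] this[of 1]]
  have "A - mat ?c = 0" by (simp add: Suc_le_eq)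
  then show ?thesis by auto
qed

lemma frame_map_unitary:
  fixes B :: "nat \<Rightarrow> (complex^'n) set"
  assumes B: "complete_MUB B" and X: "invertible X"
    and img: "\<And>i. i \<le> CARD('n) \<Longrightarrow> \<exists>j\<le>CARD('n). (`) (semi b X) ` Ort (B i) = Ort (B j)"
  shows "\<exists>c. c \<noteq> 0 \<and> hadj X ** X = mat c"
proof -
  \<comment> \<open>The Gram matrix of the map, read in conjugated coordinates when \<tau> is
    present, so that orthogonality of images becomes \<open>herm x (P *v y) = 0\<close> in both
    cases.\<close>
  define P where "P = (if b then cnj_mat (hadj X ** X) else hadj X ** X)"
  have P: "herm (semi b X x) (semi b X y) = (if b then cnj (herm x (P *v y)) else herm x (P *v y))" for x y
  proof -
    have "herm (X *v u) (X *v v) = herm u ((hadj X ** X) *v v)" for u v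
      by (simp add: herm_hadj matrix_vector_mul_assoc)
    moreover have "(hadj X ** X) *v conjugation y = conjugation (P *v y)" if b
      using that by (simp add: P_def conjugation_mult_vec)
    ultimately show ?thesis
      by (auto simp: semi_def P_def herm_conjugation)
  qed
  have "\<exists>c. P *v y = c *s y" if i: "i \<le> CARD('n)" and y: "y \<in> B i" for i y
  proof -
    note E = complete_MUBD(1)[OF B i]
    obtain j where j: "j \<le> CARD('n)" "(`) (semi b X) ` Ort (B i) = Ort (B j)" using img[OF i] by blast
    note C = complete_MUBD(1)[OF B j(1)]
    \<comment> \<open>Distinct lines of \<open>B i\<close> go to distinct lines of
      \<open>B j\<close>, so \<open>P *v y\<close> is orthogonal to all other vectors of
      \<open>B i\<close> and hence is a multiple of \<open>y\<close>.\<close>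
    have orth: "herm (P *v y) x = 0" if x: "x \<in> B i" "x \<noteq> y" for x
    proof -
      obtain x' y' a c where xy: "x' \<in> B j" "semi b X x = a *s x'" "a \<noteq> 0" "y' \<in> B j" "semi b X y = c *s y'" "c \<noteq> 0"
        using frame_image(1)[OF X j(2) E] x y by meson
      have "x' \<noteq> y'"
      proof
        assume "x' = y'"
        then have "semi b X ` vec.span {x} = semi b X ` vec.span {y}"
          using semi_image_line[OF xy(2,3)] semi_image_line[OF xy(5,6)] by simp
        then have "vec.span {x} = vec.span {y}"
          using bij_semi[OF X, of b] by (simp add: inj_image_eq_iff bij_is_inj)
        then show False using inj_on_line[OF E] x y by (auto dest: inj_onD)
      qed
      then have "herm (semi b X x) (semi b X y) = 0"
        using xy orthonormal_basisD(5)[OF C] by (simp add: herm_linear_left herm_linear_right)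
      then have "herm x (P *v y) = 0" unfolding P by (auto split: if_splits)
      then show ?thesis by (simp add: herm_commute[of "P *v y" x])
    qed
    have "P *v y = (\<Sum>x\<in>B i. proj x) *v (P *v y)" unfolding sum_proj_onb[OF E] by simp
    also have "\<dots> = (\<Sum>x\<in>B i. if x = y then herm (P *v y) y *s y else 0)"
      unfolding matrix_sum_vec by (intro sum.cong refl) (auto simp: proj_mult_vec orth)
    also have "\<dots> = herm (P *v y) y *s y" using y orthonormal_basisD(1)[OF E] by simp
    finally show ?thesis by blast
  qed
  then obtain c where c: "P = mat c"
    using scalar_if_diagonal_twice[OF B, of P] by blast
  then have "hadj X ** X = mat (if b then cnj c else c)"
    unfolding P_def by (cases b) (auto dest: arg_cong[where f = cnj_mat])
  moreover have "hadj X ** X \<noteq> 0"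
  proof
    assume "hadj X ** X = 0"
    then have "hadj X ** X = 0 ** X" by simp
    then have "hadj X = 0" unfolding invertible_cancel_right[OF X] .
    then have "X = 0" using hadj_hadj[of X] by (simp add: hadj_def vec_eq_iff)
    then show False
      using semi_eq_0[OF X, of False "axis undefined 1"] by (simp add: semi_def axis_eq_0_iff)
  qed
  ultimately show ?thesis by (metis mat_zero)
qed

lemma frame_maps_subgroup:
  fixes B :: "nat \<Rightarrow> (complex^'n) set"
  shows "subgroup (frame_maps B) GL_plus"
proof -
  interpret group "GL_plus :: (complex^'n \<Rightarrow> complex^'n) monoid" by (rule group_GL_plus)
  show ?thesis
  proof (rule subgroupI)
    show "frame_maps B \<subseteq> carrier GL_plus" by (auto simp: frame_maps_def)
    have "id \<in> frame_maps B"
      using one_closed by (auto simp: frame_maps_def GL_plus_simps)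
    then show "frame_maps B \<noteq> {}" by blast
  next
    fix f assume f: "f \<in> frame_maps B"
    then have fc: "f \<in> carrier GL_plus" by (simp add: frame_maps_def)
    define g where "g = inv\<^bsub>GL_plus\<^esub> f"
    have gc: "g \<in> carrier GL_plus" using fc by (simp add: g_def)
    have gf: "g \<circ> f = id"
      using l_inv[OF fc] by (simp add: g_def GL_plus_simps fc flip: GL_plus_simps(2))
    \<comment> \<open>Of \<open>f\<close> it is only known that each frame goes to some frame.
      Acting injectively on the finite set of orthoframes, it permutes them, so the inverse maps
      frames to frames as well.\<close>
    define Os where "Os = (\<lambda>i. Ort (B i)) ` {..CARD('n)}"
    have "(\<lambda>L. (`) f ` L) ` Os \<subseteq> Os"
      using f by (auto simp: Os_def frame_maps_def)
    moreover have "inj_on (\<lambda>L. (`) f ` L) Os"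
    proof (rule inj_onI)
      fix L M assume "(`) f ` L = (`) f ` M"
      then have "(`) g ` (`) f ` L = (`) g ` (`) f ` M" by simp
      then show "L = M" using gf by (simp add: image_image fun_eq_iff)
    qed
    moreover have "finite Os" by (simp add: Os_def)
    ultimately have Os: "(\<lambda>L. (`) f ` L) ` Os = Os" by (rule endo_inj_surj[rotated])
    have "\<exists>j\<le>CARD('n). (`) g ` Ort (B i) = Ort (B j)" if "i \<le> CARD('n)" for i
    proof -
      have "Ort (B i) \<in> Os" using that by (simp add: Os_def)
      then have "Ort (B i) \<in> (\<lambda>L. (`) f ` L) ` Os" unfolding Os .
      then obtain j where j: "j \<le> CARD('n)" "Ort (B i) = (`) f ` Ort (B j)"
        by (auto simp: Os_def)
      have "(`) g ` Ort (B i) = (\<lambda>L. (g \<circ> f) ` L) ` Ort (B j)"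
        by (simp add: j(2) image_image)
      then show ?thesis using gf j by auto
    qed
    then show "inv\<^bsub>GL_plus\<^esub> f \<in> frame_maps B"
      using gc by (simp add: frame_maps_def g_def)
  next
    fix f g assume f: "f \<in> frame_maps B" and g: "g \<in> frame_maps B"
    then have c: "f \<in> carrier GL_plus" "g \<in> carrier GL_plus" by (simp_all add: frame_maps_def)
    have "\<exists>j\<le>CARD('n). (`) (f \<circ> g) ` Ort (B i) = Ort (B j)" if i: "i \<le> CARD('n)" for i
    proof -
      obtain j where j: "j \<le> CARD('n)" "(`) g ` Ort (B i) = Ort (B j)"
        using g i by (auto simp: frame_maps_def)
      obtain k where k: "k \<le> CARD('n)" "(`) f ` Ort (B j) = Ort (B k)"
        using f j by (auto simp: frame_maps_def)
      have "(`) (f \<circ> g) ` Ort (B i) = (`) f ` (`) g ` Ort (B i)"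
        by (simp add: image_image image_comp)
      then show ?thesis using j k by auto
    qed
    then show "f \<otimes>\<^bsub>GL_plus\<^esub> g \<in> frame_maps B"
      using m_closed[OF c] c by (simp add: frame_maps_def GL_plus_simps)
  qed
qed

section \<open>The adjoint action\<close>

definition Adm :: "bool \<Rightarrow> complex^'n^'n \<Rightarrow> complex^'n^'n \<Rightarrow> complex^'n^'n" where
  "Adm b X A = (if b then - (X ** transpose A ** matrix_inv X) else X ** A ** matrix_inv X)"

lemma Adm_mult:
  assumes "invertible X"
  shows "Adm b X A ** X = (if b then - (X ** transpose A) else X ** A)"
  using matrix_inv_right_left(2)[OF assms]
  by (simp add: Adm_def matrix_minus_left flip: matrix_mul_assoc)

text \<open>Right multiplication by \<open>X\<close> removes the inverse; identities for
  \<open>Adm\<close> are checked in this form.\<close>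

lemma Adm_eq_iff:
  assumes "invertible X"
  shows "Adm b X A = Z \<longleftrightarrow> Z ** X = (if b then - (X ** transpose A) else X ** A)"
  unfolding invertible_cancel_right[OF assms, of "Adm b X A" Z, symmetric] Adm_mult[OF assms]
  by (rule eq_commute)

lemma trace_Adm:
  assumes "invertible X"
  shows "trace (Adm b X A) = (if b then - trace A else trace A)"
proof -
  have "trace (X ** M ** matrix_inv X) = trace M" for M
    using trace_mul_sym[of "X ** M" "matrix_inv X"] matrix_inv_right_left[OF assms]
    by (simp add: matrix_mul_assoc)
  then show ?thesis by (simp add: Adm_def trace_minus trace_transpose)
qed

text \<open>Transposition alone reverses products and so negates brackets; the minus sign in the
  contragredient case repairs this.\<close>

lemma Adm_lie:
  assumes X: "invertible X"
  shows "Adm b X (lie A C) = lie (Adm b X A) (Adm b X C)"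
  unfolding Adm_eq_iff[OF X]
  by (cases b) (simp_all add: lie_def matrix_diff_rdistrib matrix_diff_ldistrib Adm_mult[OF X] transpose_distribs
    matrix_transpose_mul matrix_minus_right matrix_minus_left matrix_mul_assoc[symmetric],
    simp_all add: Adm_mult[OF X] matrix_mul_assoc matrix_minus_left)

lemma bij_betw_Adm:
  assumes X: "invertible X"
  shows "bij_betw (Adm b X) sl sl"
proof (rule bij_betw_imageI)
  show "inj_on (Adm b X) sl"
  proof (rule inj_onI)
    fix A C assume "Adm b X A = Adm b X C"
    then have "Adm b X A ** X = Adm b X C ** X" by simp
    then show "A = C" unfolding Adm_mult[OF X] using invertible_cancel_left[OF X] by (auto split: if_splits)
  qed
  have "Adm b X A \<in> sl" if "A \<in> sl" for A
    using that by (simp add: sl_def trace_Adm[OF X])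
  moreover have "\<exists>A\<in>sl. Adm b X A = Z" if "Z \<in> sl" for Z
  proof -
    define M where "M = matrix_inv X ** Z ** X"
    define A where "A = (if b then - transpose M else M)"
    have "X ** M = Z ** X" using matrix_inv_right_left[OF X] by (simp add: M_def matrix_mul_assoc)
    then have "Adm b X A = Z"
      unfolding Adm_eq_iff[OF X] by (simp add: A_def transpose_distribs matrix_minus_right)
    moreover from this have "A \<in> sl" using that trace_Adm[OF X, of b A] by (auto simp: sl_def split: if_splits)
    ultimately show ?thesis by blast
  qed
  ultimately show "Adm b X ` sl = sl" by blast
qed

lemma Adm_compose:
  assumes X: "invertible X" and Y: "invertible Y" and U: "hadj Y ** Y = mat d" "d \<noteq> 0"
  shows "Adm (b \<noteq> c) (X ** (if b then cnj_mat Y else Y)) A = Adm b X (Adm c Y A)"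
proof -
  have inv: "invertible (X ** (if b then cnj_mat Y else Y))"
    using X Y by (simp add: invertible_mult invertible_cnj_mat)
  let ?Z = "Adm c Y A"
  show ?thesis
  proof (cases b)
    case False
    have "Adm b X ?Z ** (X ** Y) = X ** (?Z ** Y)"
      by (simp add: False matrix_mul_assoc Adm_mult[OF X])
    then show ?thesis
      unfolding Adm_eq_iff[OF inv] using False
      by (simp add: Adm_mult[OF Y] matrix_mul_assoc matrix_minus_right)
  next
    case True
    let ?W = "cnj_mat Y"
    \<comment> \<open>The transpose of \<open>U\<close>: up to the factor \<open>d\<close>, the
      conjugate \<open>?W\<close> is the inverse transpose of \<open>Y\<close>, so conjugation by
      either matrix is the same.\<close>
    have YW: "transpose Y ** ?W = mat d"
      using arg_cong[OF U(1), of transpose]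
      by (simp add: matrix_transpose_mul transpose_eq_cnj_hadj[of "hadj Y"])
    have WY: "?W ** transpose Y = mat d"
    proof -
      have "transpose Y ** mat_scale (inverse d) ?W = mat 1"
        using YW U(2) by (simp add: mat_scale_mult_right flip: mat_mult)
      then have "mat_scale (inverse d) ?W ** transpose Y = mat 1"
        by (simp add: matrix_left_right_inverse)
      then have "mat_scale d (mat_scale (inverse d) ?W ** transpose Y) = mat d"
        by (simp flip: mat_mult)
      then show ?thesis using U(2) by (simp add: mat_scale_mult_left)
    qed
    define s :: complex where "s = (if c then -1 else 1)"
    define A' where "A' = (if c then transpose A else A)"
    have ZY: "?Z ** Y = mat_scale s (Y ** A')"
      by (simp add: Adm_mult[OF Y] s_def A'_def)
    note m = mult_mat
    have "transpose Y ** transpose ?Z = mat_scale s (transpose A' ** transpose Y)"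
      using arg_cong[OF ZY, of transpose] by (simp add: matrix_transpose_mul transpose_distribs)
    \<comment> \<open>With \<open>?W\<close> on both sides, \<open>transpose Y\<close> meets a
      \<open>?W\<close> in each member and turns into the scalar \<open>d\<close>, which then
      cancels.\<close>
    then have "?W ** (transpose Y ** transpose ?Z) ** ?W = ?W ** mat_scale s (transpose A' ** transpose Y) ** ?W"
      by simp
    then have "(?W ** transpose Y) ** transpose ?Z ** ?W = mat_scale s (?W ** transpose A' ** (transpose Y ** ?W))"
      by (simp add: matrix_mul_assoc mat_scale_mult_right mat_scale_mult_left)
    then have "mat_scale d (transpose ?Z ** ?W) = mat_scale d (mat_scale s (?W ** transpose A'))"
      by (simp add: WY YW m mat_scale_mult_left mult.commute)
    then have ZW: "transpose ?Z ** ?W = mat_scale s (?W ** transpose A')"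
      using U(2) by (rule mat_vs.scale_left_imp_eq[rotated])
    have "Adm b X ?Z ** (X ** ?W) = - (X ** (transpose ?Z ** ?W))"
      by (simp add: True matrix_mul_assoc Adm_mult[OF X] matrix_minus_left)
    also have "\<dots> = - mat_scale s (X ** ?W ** transpose A')"
      by (simp add: ZW mat_scale_mult_right matrix_mul_assoc)
    finally show ?thesis
      unfolding Adm_eq_iff[OF inv] using True by (auto simp: s_def A'_def)
  qed
qed

text \<open>For a conjugate-linear map the transpose applied to a conjugated vector is the conjugate
  of the adjoint applied to the vector. Closure of diagonal algebras under \<open>hadj\<close> then
  reduces this case to eigenvectors of \<open>hadj A\<close>.\<close>

lemma Adm_diagonal_algebra:
  fixes E C :: "(complex^'n) set"
  assumes X: "invertible X" and E: "orthonormal_basis E" and C: "orthonormal_basis C"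
    and img: "(`) (semi b X) ` Ort E = Ort C"
  shows "Adm b X ` diagonal_algebra E = diagonal_algebra C"
proof -
  note transpose_matrix_vector [simp del]
  let ?x = "\<lambda>x. if b then conjugation x else x" and ?A = "\<lambda>A. if b then - transpose A else A"
  have XA: "Adm b X A ** X = X ** ?A A" for A
    by (simp add: Adm_mult[OF X] matrix_minus_right)
  have tr: "transpose A *v conjugation x = conjugation (hadj A *v x)" for A :: "complex^'n^'n" and x
    by (simp add: transpose_eq_cnj_hadj conjugation_mult_vec)
  have neg: "(- M) *v x = - (M *v x)" for M :: "complex^'n^'n" and x
    using matrix_vector_mult_diff_rdistrib[of 0 M x] by simp
  have "Adm b X A \<in> diagonal_algebra C" if A: "A \<in> diagonal_algebra E" for A
  proof -
    have "\<exists>a. Adm b X A *v y = a *s y" if y: "y \<in> C" for y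
    proof -
      obtain x c where x: "x \<in> E" "c \<noteq> 0" "semi b X x = c *s y"
        using frame_image(2)[OF X img E y] by blast
      obtain a1 where a1: "A *v x = a1 *s x" using A x(1) unfolding diagonal_algebra_def by blast
      obtain a2 where a2: "hadj A *v x = a2 *s x"
        using hadj_diagonal_algebra[OF E A] x(1) unfolding diagonal_algebra_def by blast
      define a where "a = (if b then - cnj a2 else a1)"
      have "?A A *v ?x x = a *s ?x x"
        using a1 a2 by (simp add: a_def neg tr conjugation_scale)
      then have "Adm b X A *v (X *v ?x x) = a *s (X *v ?x x)"
        by (simp only: matrix_vector_mul_assoc XA) (simp add: matrix_vector_mul_assoc[symmetric] vec.scale)
      then have "Adm b X A *v (c *s y) = a *s (c *s y)"
        using x(3) by (simp add: semi_def)
      then have "c *s (Adm b X A *v y) = c *s (a *s y)"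
        by (simp add: vec.scale mult.commute)
      then show ?thesis using x(2) vec.scale_left_imp_eq by blast
    qed
    moreover have "Adm b X A \<in> sl"
      using A trace_Adm[OF X, of b A] by (auto simp: diagonal_algebra_def sl_def)
    ultimately show ?thesis by (simp add: diagonal_algebra_def)
  qed
  moreover have "A \<in> diagonal_algebra E" if A: "A \<in> sl" "Adm b X A \<in> diagonal_algebra C" for A
  proof -
    have eig: "\<exists>a. ?A A *v ?x x = a *s ?x x" if x: "x \<in> E" for x
    proof -
      obtain y c where y: "y \<in> C" "c \<noteq> 0" "semi b X x = c *s y"
        using frame_image(1)[OF X img E x] by blast
      obtain a where "Adm b X A *v y = a *s y" using A(2) y(1) unfolding diagonal_algebra_def by blast
      then have "Adm b X A *v (X *v ?x x) = a *s (X *v ?x x)"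
        using y(3) by (simp add: semi_def vec.scale mult.commute)
      then have "X *v (?A A *v ?x x) = X *v (a *s ?x x)"
        by (simp only: matrix_vector_mul_assoc XA vec.scale)
      then have "?A A *v ?x x = a *s ?x x"
        by (metis X matrix_inv_right_left(2) matrix_vector_mul_assoc matrix_vector_mul_lid)
      then show ?thesis by blast
    qed
    show ?thesis
    proof (cases b)
      case False
      then show ?thesis using eig A by (simp add: diagonal_algebra_def)
    next
      case True
      have "\<exists>a. hadj A *v x = a *s x" if x: "x \<in> E" for x
      proof -
        obtain a where "- (transpose A *v conjugation x) = a *s conjugation x"
          using eig[OF x] True by (auto simp: neg)
        then have "transpose A *v conjugation x = (- a) *s conjugation x"
          by (metis vec.scale_minus_left minus_minus)
        then have "conjugation (hadj A *v x) = conjugation (cnj (- a) *s x)"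
          by (simp only: tr conjugation_scale complex_cnj_cnj)
        then have "hadj A *v x = cnj (- a) *s x"
          by (metis conjugation_conjugation)
        then show ?thesis by blast
      qed
      then have "hadj A \<in> diagonal_algebra E" using A by (simp add: diagonal_algebra_def sl_def trace_hadj)
      then show ?thesis using hadj_diagonal_algebra[OF E, of "hadj A"] by simp
    qed
  qed
  moreover have "diagonal_algebra C \<subseteq> Adm b X ` sl"
    using bij_betw_Adm[OF X, of b] diagonal_algebra_subset_sl unfolding bij_betw_def by blast
  ultimately show ?thesis by blast
qed

text \<open>Conjugation fixes the standard basis, so \<open>matrix f\<close> recovers \<open>X\<close> from \<open>X\<close> as well as from
  \<open>X\<tau>\<close>.\<close>

definition Ad :: "(complex^'n \<Rightarrow> complex^'n) \<Rightarrow> complex^'n^'n \<Rightarrow> complex^'n^'n" where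
  "Ad f = restrict (Adm (f \<notin> GL_maps) (matrix f)) sl"

lemma Ad_semi: "invertible X \<Longrightarrow> Ad (semi b X) = restrict (Adm b X) sl"
  by (simp add: Ad_def matrix_semi semi_in_GL_maps)

lemma Ad_in_Bij: "f \<in> carrier GL_plus \<Longrightarrow> Ad f \<in> Bij sl"
  using bij_betw_Adm by (auto simp: carrier_GL_plus Ad_semi Bij_def)

lemma Ad_lie_automorphism:
  assumes "f \<in> carrier GL_plus"
  shows "Ad f \<in> lie_automorphisms"
proof -
  obtain b X where f: "f = semi b X" "invertible X" using assms unfolding carrier_GL_plus by blast
  have add: "Adm b X (A + C) = Adm b X A + Adm b X C" for A C
    by (simp add: Adm_def transpose_distribs matrix_distribs)
  have scale: "Adm b X (mat_scale c A) = mat_scale c (Adm b X A)" for c A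
    by (simp add: Adm_def transpose_distribs matrix_distribs)
  show ?thesis
    using Ad_in_Bij[OF assms] mat_vs.subspace_add[OF subspace_sl] mat_vs.subspace_scale[OF subspace_sl]
    by (auto simp: lie_automorphisms_def f Ad_semi[OF f(2)] add scale Adm_lie[OF f(2)])
qed

text \<open>Membership of the second map in \<open>frame_maps\<close> supplies, through
  \<open>frame_map_unitary\<close>, the unitarity up to a scalar that \<open>Adm_compose\<close>
  requires.\<close>

lemma Ad_hom:
  fixes B :: "nat \<Rightarrow> (complex^'n) set"
  assumes B: "complete_MUB B"
  shows "Ad \<in> hom (GL_plus\<lparr>carrier := frame_maps B\<rparr>) (BijGroup sl)"
proof (rule homI)
  fix f assume "f \<in> carrier (GL_plus\<lparr>carrier := frame_maps B\<rparr>)"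
  then show "Ad f \<in> carrier (BijGroup sl)"
    using Ad_in_Bij by (auto simp: frame_maps_def BijGroup_def)
next
  fix f g assume "f \<in> carrier (GL_plus\<lparr>carrier := frame_maps B\<rparr>)" "g \<in> carrier (GL_plus\<lparr>carrier := frame_maps B\<rparr>)"
  then have fg: "f \<in> frame_maps B" "g \<in> frame_maps B" by simp_all
  then have c: "f \<in> carrier GL_plus" "g \<in> carrier GL_plus" by (simp_all add: frame_maps_def)
  obtain b X where f: "f = semi b X" "invertible X" using frame_mapsE[OF fg(1)] by metis
  obtain c Y where g: "g = semi c Y" "invertible Y"
    and img: "\<And>i. i \<le> CARD('n) \<Longrightarrow> \<exists>j\<le>CARD('n). (`) (semi c Y) ` Ort (B i) = Ort (B j)"
    using frame_mapsE[OF fg(2)] by metis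
  obtain d where d: "d \<noteq> 0" "hadj Y ** Y = mat d"
    using frame_map_unitary[OF B g(2) img] by blast
  have inv: "invertible (X ** (if b then cnj_mat Y else Y))"
    using f g by (simp add: invertible_mult invertible_cnj_mat)
  have "Ad (f \<circ> g) = (\<lambda>A\<in>sl. Adm b X (Adm c Y A))"
    unfolding f(1) g(1) semi_compose Ad_semi[OF inv] Adm_compose[OF f(2) g(2) d(2,1)] ..
  then have "Ad (f \<circ> g) = compose sl (Ad f) (Ad g)"
    using bij_betwE[OF bij_betw_Adm[OF g(2), of c]]
    by (auto simp: f(1) g(1) Ad_semi[OF f(2)] Ad_semi[OF g(2)] compose_def restrict_def fun_eq_iff)
  then show "Ad (f \<otimes>\<^bsub>GL_plus\<lparr>carrier := frame_maps B\<rparr>\<^esub> g) = Ad f \<otimes>\<^bsub>BijGroup sl\<^esub> Ad g"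
    using c by (simp add: GL_plus_simps BijGroup_def Ad_in_Bij)
qed

section \<open>Kernel and image of the adjoint action\<close>

lemma scalar_maps_eq: "(scalar_maps :: (complex^'n \<Rightarrow> complex^'n) set) = {semi False (mat c) | c. c \<noteq> 0}"
proof -
  have "(*s) c = (semi False (mat c) :: complex^'n \<Rightarrow> complex^'n)" for c by (simp add: fun_eq_iff semi_def mat_vector_mult)
  then show ?thesis by (simp add: scalar_maps_def)
qed

lemma invertible_mat: "c \<noteq> 0 \<Longrightarrow> invertible (mat c :: complex^'n^'n)"
  unfolding invertible_def
  by (rule exI[of _ "mat (inverse c)"])
    (simp add: mat_eq_scale[of c] mat_eq_scale[of "inverse c"] mat_scale_mult_left mat_scale_mult_right)

text \<open>The eigenvalues of \<open>proj0 x\<close> are \<open>1 - 1/n\<close>, simple, and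
  \<open>-1/n\<close>, with multiplicity \<open>n - 1\<close>; negation respects this pattern only
  for \<open>n = 2\<close>. The proof tests the relation on a vector orthogonal to \<open>x\<close>:
  there the idempotent \<open>X R X^-1\<close> acts as \<open>2/n\<close>, so
  \<open>2/n = 1\<close>.\<close>

lemma Adm_True_not_id:
  fixes X :: "complex^'n^'n"
  assumes n: "CARD('n) \<ge> 3" and X: "invertible X" and x: "herm x x = 1"
  shows "Adm True X (proj0 x) \<noteq> proj0 x"
proof
  assume "Adm True X (proj0 x) = proj0 x"
  then have "proj0 x ** X = - (X ** transpose (proj0 x))"
    unfolding Adm_eq_iff[OF X] by simp
  define R where "R = transpose (proj x)"
  have RR: "R ** R = R"
    unfolding R_def by (simp add: proj_mult_proj_self[OF x] flip: matrix_transpose_mul)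
  have "proj x ** X + X ** R = mat_scale (2 / of_nat CARD('n)) X"
  proof -
    note m = mult_mat
    have "proj x ** X - mat_scale (1 / of_nat CARD('n)) X = - (X ** R - mat_scale (1 / of_nat CARD('n)) X)"
      using \<open>proj0 x ** X = _\<close>
      by (simp add: proj0_def matrix_diff_rdistrib matrix_diff_ldistrib transpose_distribs m R_def)
    then have "proj x ** X + X ** R = mat_scale (1 / of_nat CARD('n)) X + mat_scale (1 / of_nat CARD('n)) X"
      by (simp add: algebra_simps)
    then show ?thesis by (simp flip: mat_vs.scale_left_distrib)
  qed
  then have eq: "proj x *v (X *v w) + X *v (R *v w) = (2 / of_nat CARD('n)) *s (X *v w)" for w
    by (metis matrix_vector_mul_assoc matrix_vector_mult_add_rdistrib mat_scale_mult_vec)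
  obtain v where v: "v \<noteq> 0" "herm v x = 0" using exists_orthogonal_vector[OF n, of x x] by blast
  define u where "u = matrix_inv X *v v"
  have u: "X *v u = v"
    using matrix_inv_right_left[OF X] by (simp add: u_def matrix_vector_mul_assoc)
  let ?a = "2 / of_nat CARD('n) :: complex"
  have 1: "X *v (R *v u) = ?a *s v"
    using eq[of u] v by (simp add: u proj_mult_vec)
  have "X *v (R *v (R *v u)) = ?a *s (?a *s v)"
    using eq[of "R *v u"] v by (simp add: 1 proj_mult_vec herm_linear_left del: vec.scale_scale)
  then have "?a *s v = (?a * ?a) *s v"
    by (simp add: matrix_vector_mul_assoc[of R R] RR 1)
  then have "?a = ?a * ?a" using v(1) vec.scale_right_imp_eq by blast
  then have "of_nat CARD('n) = (of_nat 2 :: complex)" by (simp add: field_simps)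
  then show False using n unfolding of_nat_eq_iff by simp
qed

text \<open>A linear map acting trivially commutes with every \<open>proj x\<close>, so all vectors
  of all bases are eigenvectors and the matrix is scalar. A single vector of \<open>B 0\<close>
  rules out the conjugate-linear case.\<close>

lemma kernel_Ad:
  fixes B :: "nat \<Rightarrow> (complex^'n) set"
  assumes n: "CARD('n) \<ge> 3" and B: "complete_MUB B"
  shows "kernel (GL_plus\<lparr>carrier := frame_maps B\<rparr>) (BijGroup sl) Ad = scalar_maps"
proof (intro equalityI subsetI)
  fix f assume "f \<in> kernel (GL_plus\<lparr>carrier := frame_maps B\<rparr>) (BijGroup sl) Ad"
  then have f: "f \<in> frame_maps B" "Ad f = (\<lambda>A\<in>sl. A)"
    by (simp_all add: kernel_def BijGroup_def)
  obtain b X where X: "f = semi b X" "invertible X" using frame_mapsE[OF f(1)] by metis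
  have id: "Adm b X A = A" if "A \<in> sl" for A
    using f(2) that unfolding X(1) Ad_semi[OF X(2)] by (metis restrict_apply')
  have unit: "herm x x = 1" "proj0 x \<in> sl" if "i \<le> CARD('n)" "x \<in> B i" for i x
    using orthonormal_basisD(4)[OF complete_MUBD(1)[OF B that(1)] that(2)]
    by (simp_all add: sl_def trace_proj0)
  have "\<not> b"
  proof
    assume b
    have "B 0 \<noteq> {}" using orthonormal_basisD(2)[OF complete_MUBD(1)[OF B, of 0]] by auto
    then obtain x where "x \<in> B 0" by blast
    then show False using Adm_True_not_id[OF n X(2)] unit[of 0 x] id[of "proj0 x"] \<open>b\<close> by simp
  qed
  have "\<exists>c. X *v x = c *s x" if x: "i \<le> CARD('n)" "x \<in> B i" for i x
  proof -
    have "proj0 x ** X = X ** proj0 x"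
      using id[OF unit(2)[OF x]] \<open>\<not> b\<close> unfolding Adm_eq_iff[OF X(2)] by simp
    then have "proj x ** X = X ** proj x"
      by (simp add: proj0_def matrix_diff_rdistrib matrix_diff_ldistrib
          mat_eq_scale[of "1 / _"] mat_scale_mult_left mat_scale_mult_right)
    then have "proj x *v (X *v x) = X *v (proj x *v x)"
      by (simp add: matrix_vector_mul_assoc)
    then show ?thesis using unit(1)[OF x] by (simp add: proj_mult_vec) metis
  qed
  from scalar_if_diagonal_twice[OF B, of X] this obtain c where c: "X = mat c" by blast
  moreover have "c \<noteq> 0"
    using semi_eq_0[OF X(2), of False "axis undefined 1"] by (auto simp: c semi_def axis_eq_0_iff)
  ultimately show "f \<in> scalar_maps" using \<open>\<not> b\<close> X by (auto simp: scalar_maps_eq)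
next
  fix f :: "complex^'n \<Rightarrow> complex^'n" assume "f \<in> scalar_maps"
  then obtain c where c: "f = semi False (mat c)" "c \<noteq> 0" by (auto simp: scalar_maps_eq)
  note inv = invertible_mat[OF c(2), where 'n = 'n]
  have "f ` L = L" if line: "L \<in> Ort E" for L E
  proof -
    obtain x where L: "L = vec.span {x}" using line by (auto simp: Ort_def)
    show ?thesis unfolding L c(1)
      by (rule semi_image_line[OF _ c(2)]) (simp add: semi_def mat_vector_mult)
  qed
  then have "(`) f ` Ort E = Ort E" for E by simp
  then have "f \<in> frame_maps B"
    using inv c(1) by (auto simp: frame_maps_def carrier_GL_plus)
  moreover have "Ad f = (\<lambda>A\<in>sl. A)"
  proof -
    have "Adm False (mat c) A = A" for A :: "complex^'n^'n"
      unfolding Adm_eq_iff[OF inv]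
      by (simp add: mat_eq_scale[of c] mat_scale_mult_left mat_scale_mult_right)
    then show ?thesis unfolding c(1) Ad_semi[OF inv] by (simp add: restrict_def fun_eq_iff)
  qed
  ultimately show "f \<in> kernel (GL_plus\<lparr>carrier := frame_maps B\<rparr>) (BijGroup sl) Ad"
    by (simp add: kernel_def BijGroup_def)
qed

text \<open>Surjectivity needs more than an implementing matrix \<open>X\<close>: the semilinear map
  built from it has to permute the orthoframes. This follows from the images of the matrices
  \<open>proj0 x\<close>.\<close>

lemma image_Ad:
  fixes B :: "nat \<Rightarrow> (complex^'n) set"
  assumes n: "CARD('n) \<ge> 3" and B: "complete_MUB B"
  shows "Ad ` frame_maps B = carrier (Aut_decomposition (\<lambda>i. diagonal_algebra (B i)))"
proof (intro equalityI subsetI)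
  fix \<phi> assume "\<phi> \<in> Ad ` frame_maps B"
  then obtain f where f: "f \<in> frame_maps B" "\<phi> = Ad f" by blast
  obtain b X where X: "f = semi b X" "invertible X"
    "\<And>i. i \<le> CARD('n) \<Longrightarrow> \<exists>j\<le>CARD('n). (`) (semi b X) ` Ort (B i) = Ort (B j)"
    using frame_mapsE[OF f(1)] by metis
  have "\<exists>j\<le>CARD('n). \<phi> ` diagonal_algebra (B i) = diagonal_algebra (B j)" if i: "i \<le> CARD('n)" for i
  proof -
    obtain j where j: "j \<le> CARD('n)" "(`) (semi b X) ` Ort (B i) = Ort (B j)" using X(3)[OF i] by blast
    have "\<phi> ` diagonal_algebra (B i) = Adm b X ` diagonal_algebra (B i)"
      unfolding f(2) X(1) Ad_semi[OF X(2)] using diagonal_algebra_subset_sl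
      by (intro image_cong refl) auto
    then show ?thesis
      using Adm_diagonal_algebra[OF X(2) complete_MUBD(1)[OF B i] complete_MUBD(1)[OF B j(1)] j(2)] j(1)
      by auto
  qed
  moreover have "\<phi> \<in> lie_automorphisms"
    using f Ad_lie_automorphism by (auto simp: frame_maps_def)
  ultimately show "\<phi> \<in> carrier (Aut_decomposition (\<lambda>i. diagonal_algebra (B i)))"
    by (simp add: Aut_decomposition_def)
next
  fix \<phi> assume "\<phi> \<in> carrier (Aut_decomposition (\<lambda>i. diagonal_algebra (B i)))"
  then have aut: "\<phi> \<in> lie_automorphisms" and pres: "preserves_decomposition B \<phi>"
    by (simp_all add: Aut_decomposition_def preserves_decomposition_def)
  obtain X s where X: "invertible X" and s: "s \<in> {1, -1}"
    and form: "\<And>A. A \<in> sl \<Longrightarrow> \<phi> A ** X = mat_scale s (X ** (if s = 1 then A else transpose A))"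
    and im: "\<And>i j x. i \<le> CARD('n) \<Longrightarrow> j \<le> CARD('n) \<Longrightarrow> \<phi> ` diagonal_algebra (B i) = diagonal_algebra (B j) \<Longrightarrow>
      x \<in> B i \<Longrightarrow> \<exists>y\<in>B j. \<phi> (proj0 x) = mat_scale s (proj0 y)"
    using automorphism_form[OF n B aut pres] by metis
  define b where "b \<longleftrightarrow> s \<noteq> 1"
  have Adm: "Adm b X A = \<phi> A" if "A \<in> sl" for A
    unfolding Adm_eq_iff[OF X] form[OF that] using s by (auto simp: b_def)
  have "\<phi> = Ad (semi b X)"
  proof (rule extensionalityI[of _ sl])
    show "\<phi> \<in> extensional sl" using aut by (simp add: lie_automorphisms_def Bij_def)
  qed (simp_all add: Ad_semi[OF X] Adm)
  moreover have "semi b X \<in> frame_maps B"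
  proof -
    have "\<exists>j\<le>CARD('n). (`) (semi b X) ` Ort (B i) = Ort (B j)" if i: "i \<le> CARD('n)" for i
    proof -
      obtain j where j: "j \<le> CARD('n)" "\<phi> ` diagonal_algebra (B i) = diagonal_algebra (B j)"
        using pres i unfolding preserves_decomposition_def by blast
      note E = complete_MUBD(1)[OF B i] and C = complete_MUBD(1)[OF B j(1)]
      have "(`) (semi b X) ` Ort (B i) \<subseteq> Ort (B j)"
      proof
        fix L assume "L \<in> (`) (semi b X) ` Ort (B i)"
        then obtain x where x: "x \<in> B i" "L = semi b X ` vec.span {x}" by (auto simp: Ort_def)
        obtain y where y: "y \<in> B j" "\<phi> (proj0 x) = mat_scale s (proj0 y)" using im[OF i j x(1)] by blast
        have x1: "herm x x = 1" by (rule orthonormal_basisD(4)[OF E x(1)])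
        \<comment> \<open>\<open>P\<close> is \<open>proj x\<close> or its transpose, the projection
          onto the conjugate vector, and it fixes \<open>?x\<close> either way. The relation
          \<open>proj y ** X = X ** P\<close> then puts \<open>semi b X x\<close> on the line of
          \<open>y\<close>.\<close>
        define P where "P = (if b then transpose (proj x) else proj x)"
        let ?x = "if b then conjugation x else x"
        have Px: "P *v ?x = ?x"
          using proj_mult_proj_self[OF x1]
          by (simp add: P_def transpose_eq_cnj_hadj proj_mult_vec x1 flip: conjugation_mult_vec)
        have "proj0 x \<in> sl" using x1 by (simp add: sl_def trace_proj0)
        from form[OF this] have "mat_scale s (proj0 y ** X) = mat_scale s (X ** (P - mat (1 / of_nat CARD('n))))"
          unfolding y(2) by (auto simp: mat_scale_mult_left P_def b_def proj0_def transpose_distribs)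
        then have "proj0 y ** X = X ** (P - mat (1 / of_nat CARD('n)))"
          using s by (auto intro: mat_vs.scale_left_imp_eq)
        then have "proj y ** X = X ** P"
          by (simp add: proj0_def matrix_diff_rdistrib matrix_diff_ldistrib
              mat_eq_scale[of "1 / _"] mat_scale_mult_left mat_scale_mult_right)
        then have "proj y *v (X *v ?x) = X *v (P *v ?x)"
          by (simp only: matrix_vector_mul_assoc)
        then have fx: "semi b X x = herm (semi b X x) y *s y"
          by (simp add: Px proj_mult_vec semi_def)
        moreover have "herm (semi b X x) y \<noteq> 0"
          using fx semi_eq_0[OF X, of b x] onb_nonzero[OF E x(1)] by auto
        ultimately have "L = vec.span {y}" unfolding x(2) by (rule semi_image_line)
        then show "L \<in> Ort (B j)" using y(1) by (auto simp: Ort_def)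
      qed
      \<comment> \<open>Both frames consist of \<open>n\<close> lines, so the inclusion is an
        equality.\<close>
      moreover have "card ((`) (semi b X) ` Ort (B i)) = card (Ort (B j))"
      proof -
        have "inj_on ((`) (semi b X)) (Ort (B i))"
          using bij_semi[OF X, of b] by (intro inj_onI) (simp add: inj_image_eq_iff bij_is_inj)
        then show ?thesis using Ort_finite_card[OF E] Ort_finite_card[OF C] by (simp add: card_image)
      qed
      ultimately have "(`) (semi b X) ` Ort (B i) = Ort (B j)"
        by (rule card_subset_eq[OF Ort_finite_card(1)[OF C]])
      then show ?thesis using j(1) by auto
    qed
    then show ?thesis using X by (auto simp: frame_maps_def carrier_GL_plus)
  qed
  ultimately show "\<phi> \<in> Ad ` frame_maps B" by blast
qed

text \<open>Scalar maps fix every line, so a coset acts on lines as any representative does, and the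
  condition on cosets turns into the one defining \<open>frame_maps\<close>.\<close>

lemma Aut_MUB_eq:
  fixes B :: "nat \<Rightarrow> (complex^'n) set"
  shows "Aut_MUB B = GL_plus\<lparr>carrier := frame_maps B\<rparr> Mod scalar_maps"
proof -
  have coset: "scalar_maps #>\<^bsub>GL_plus\<^esub> f = {(*s) c \<circ> f | c. c \<noteq> 0}" if "f \<in> carrier GL_plus" for f :: "complex^'n \<Rightarrow> complex^'n"
  proof -
    have "((*s) c :: complex^'n \<Rightarrow> complex^'n) \<in> carrier GL_plus" if "c \<noteq> 0" for c
      using invertible_mat[OF that] by (auto simp: carrier_GL_plus fun_eq_iff semi_def mat_vector_mult intro!: exI[of _ False] exI[of _ "mat c"])
    then have "(*s) c \<otimes>\<^bsub>GL_plus\<^esub> f = (*s) c \<circ> f" if "c \<noteq> 0" for c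
      using that \<open>f \<in> carrier GL_plus\<close> by (simp add: GL_plus_simps)
    moreover have "scalar_maps #>\<^bsub>GL_plus\<^esub> f = {(*s) c \<otimes>\<^bsub>GL_plus\<^esub> f | c. c \<noteq> 0}"
      unfolding r_coset_def scalar_maps_def by blast
    ultimately show ?thesis by (simp cong: conj_cong) metis
  qed
  have act: "line_action (scalar_maps #>\<^bsub>GL_plus\<^esub> f) L = f ` L"
    if f: "f \<in> carrier GL_plus" and L: "L \<in> Ort E" for f :: "complex^'n \<Rightarrow> complex^'n" and L E
  proof -
    obtain b X where X: "f = semi b X" "invertible X" using f unfolding carrier_GL_plus by blast
    obtain x where x: "L = vec.span {x}" using L by (auto simp: Ort_def)
    have fL: "f ` L = vec.span {f x}"
      unfolding x X(1) by (rule semi_image_line[of _ _ _ 1]) simp_all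
    have "((*s) c \<circ> f) ` L = f ` L" if "c \<noteq> 0" for c
    proof -
      have "((*s) c \<circ> f) ` L = semi False (mat c) ` f ` L"
        by (simp add: image_comp semi_def mat_vector_mult comp_def)
      also have "\<dots> = f ` L"
        unfolding fL by (rule semi_image_line[OF _ that]) (simp add: semi_def mat_vector_mult)
      finally show ?thesis .
    qed
    then have "line_action (scalar_maps #>\<^bsub>GL_plus\<^esub> f) L = (\<Union>c\<in>{c :: complex. c \<noteq> 0}. f ` L)"
      unfolding line_action_def coset[OF f] by blast
    also have "\<dots> = f ` L" using zero_neq_one[where 'a = complex] by blast
    finally show ?thesis .
  qed
  have act': "line_action (scalar_maps #>\<^bsub>GL_plus\<^esub> f) ` Ort E = (`) f ` Ort E"
    if "f \<in> carrier GL_plus" for f :: "complex^'n \<Rightarrow> complex^'n" and E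
    using act[OF that] by (intro image_cong refl) auto
  have "{\<Psi> \<in> carrier PGL_plus. \<forall>i\<le>CARD('n). \<exists>j\<le>CARD('n). line_action \<Psi> ` Ort (B i) = Ort (B j)} =
    rcosets\<^bsub>GL_plus\<lparr>carrier := frame_maps B\<rparr>\<^esub> scalar_maps"
  proof -
    have "rcosets\<^bsub>GL_plus\<lparr>carrier := frame_maps B\<rparr>\<^esub> scalar_maps = (\<lambda>f. scalar_maps #>\<^bsub>GL_plus\<^esub> f) ` frame_maps B"
      by (auto simp: RCOSETS_def r_coset_def)
    moreover have "carrier PGL_plus = (\<lambda>f. scalar_maps #>\<^bsub>GL_plus\<^esub> f) ` carrier (GL_plus :: (complex^'n \<Rightarrow> complex^'n) monoid)"
      by (auto simp: PGL_plus_def FactGroup_def RCOSETS_def)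
    ultimately show ?thesis
      by (auto simp: frame_maps_def act')
  qed
  moreover have "set_mult GL_plus = set_mult (GL_plus\<lparr>carrier := frame_maps B\<rparr>)"
    by (simp add: fun_eq_iff set_mult_def)
  ultimately show ?thesis
    by (simp add: Aut_MUB_def PGL_plus_def FactGroup_def)
qed

theorem theorem2p2:
  fixes B :: "nat \<Rightarrow> (complex^'n) set"
  assumes "CARD('n) \<ge> 2"
    and "complete_MUB B"
  shows "orthogonal_decomposition (\<lambda>i. diagonal_algebra (B i)) \<and>
    (CARD('n) \<noteq> 2 \<longrightarrow>
      Aut_decomposition (\<lambda>i. diagonal_algebra (B i)) \<cong> Aut_MUB B)"
proof (intro conjI impI)
  show "orthogonal_decomposition (\<lambda>i. diagonal_algebra (B i))"
    by (rule MUB_orthogonal_decomposition[OF assms(2)])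
next
  assume "CARD('n) \<noteq> 2"
  with assms(1) have n: "CARD('n) \<ge> 3" by simp
  let ?G = "GL_plus\<lparr>carrier := frame_maps B\<rparr>" and ?D = "Aut_decomposition (\<lambda>i. diagonal_algebra (B i))"
  note B = assms(2)
  have G: "group ?G"
    by (rule subgroup.subgroup_is_group[OF frame_maps_subgroup group_GL_plus])
  \<comment> \<open>The group axioms for \<open>?D\<close> follow from its carrier being the image
    of a homomorphism into \<open>BijGroup sl\<close>.\<close>
  have "group_hom ?G (BijGroup sl) Ad"
    using G group_BijGroup Ad_hom[OF B] by (simp add: group_hom_def group_hom_axioms_def)
  from group_hom.img_is_subgroup[OF this] have "subgroup (carrier ?D) (BijGroup sl)"
    by (simp add: image_Ad[OF n B])
  moreover have D: "?D = BijGroup sl\<lparr>carrier := carrier ?D\<rparr>" by (simp add: Aut_decomposition_def)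
  ultimately have "group ?D"
    by (metis subgroup.subgroup_is_group group_BijGroup)
  moreover have "Ad \<in> hom ?G ?D"
  proof (rule homI)
    show "Ad f \<in> carrier ?D" if "f \<in> carrier ?G" for f
      unfolding image_Ad[OF n B, symmetric] using that by simp
    show "Ad (f \<otimes>\<^bsub>?G\<^esub> g) = Ad f \<otimes>\<^bsub>?D\<^esub> Ad g" if "f \<in> carrier ?G" "g \<in> carrier ?G" for f g
      using hom_mult[OF Ad_hom[OF B] that] by (simp add: Aut_decomposition_def)
  qed
  ultimately interpret group_hom ?G ?D Ad
    using G by (simp add: group_hom_def group_hom_axioms_def)
  have "kernel ?G ?D Ad = scalar_maps"
    unfolding kernel_Ad[OF n B, symmetric] by (simp add: kernel_def Aut_decomposition_def)
  moreover have "?G Mod kernel ?G ?D Ad \<cong> ?D"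
    by (rule FactGroup_iso) (simp add: image_Ad[OF n B])
  moreover have "group (?G Mod kernel ?G ?D Ad)"
    by (rule normal.factorgroup_is_group[OF normal_kernel])
  ultimately show "?D \<cong> Aut_MUB B"
    unfolding Aut_MUB_eq using group.iso_sym by metis
qed

end
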